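(* For every ordinal $\alpha$: $\alpha$ is the ordinal height of some automatic well-founded partial order if and only if $\alpha<\omega^\omega$.
   Context: Automatic structures: for a finite alphabet $\Sigma$ and a padding symbol $\diamond\notin\Sigma$, the convolution of a tuple $(w_1,\dots,w_n)$ of words over $\Sigma$ is the word of length $\max_i|w_i|$ over the alphabet $(\Sigma\cup\{\diamond\})^n$ whose $k$-th letter is $(\sigma_1,\dots,\sigma_n)$, where $\sigma_i$ is the $k$-th letter of $w_i$ if $k\le |w_i|$ and $\diamond$ otherwise. An $n$-ary relation on $\Sigma^\star$ is regular if the set of convolutions of its tuples is accepted by a finite automaton. A structure $(A;R_1,\dots,R_m)$ with finitely many relations is automatic over $\Sigma$ if $A\subseteq\Sigma^\star$ is a regular language and each $R_i$ is a regular relation; a structure is called automatic if it is isomorphic to such a structure. Ordinal height: for a well-founded binary relation $R$ on $A$ (no infinite sequence $x_1,x_2,\dots$ with $(x_{i+1},x_i)\in R$ for all $i$), define $r_{\mathcal A}(x)=0$ for $R$-minimal $x$ and $r_{\mathcal A}(z)=\sup\{r_{\mathcal A}(y)+1:(y,z)\in R\}$ otherwise; the ordinal height of $(A;R)$ is $r(\mathcal A)=\sup\{r_{\mathcal A}(x):x\in A\}$. For a partial order $\le$, the relevant relation is the strict order $<$. *)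

theory Defs
  imports Complex_Main "HOL-Library.Infinite_Typeclass"
begin

unbundle cardinal_syntax

section \<open>Ordinals\<close>

text \<open>
  The elements of \<open>'a ordinal\<close> are the order types of the well-orders on subsets of \<^typ>\<open>'a\<close>,
  that is, the ordinals of cardinality at most that of \<^typ>\<open>'a\<close>.  As \<^typ>\<open>'a\<close> varies, every ordinal is
  obtained.
\<close>

quotient_type 'a ordinal = "'a rel" / partial: "\<lambda>r s. r =o s"
proof (rule part_equivpI)
  show "\<exists>r :: 'a rel. r =o r"
    by (rule exI[of _ "{}"]) (simp add: ordIso_reflexive well_order_on_empty)
  show "symp (\<lambda>r s :: 'a rel. r =o s)"
    by (auto intro!: sympI ordIso_symmetric)
  show "transp (\<lambda>r s :: 'a rel. r =o s)"
    by (auto intro!: transpI elim: ordIso_transitive)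
qed

lemma ordIso_self_iff: "r =o r \<longleftrightarrow> Well_order r"
  by (auto simp: ordIso_reflexive) (simp add: ordIso_def)

lemma ordinal_cases:
  obtains r where "x = abs_ordinal r" "Well_order r"
proof
  show "x = abs_ordinal (rep_ordinal x)"
    by (rule Quotient3_abs_rep[OF Quotient3_ordinal, symmetric])
  show "Well_order (rep_ordinal x)"
    using Quotient3_rep_reflp[OF Quotient3_ordinal, of x] by (simp add: ordIso_self_iff)
qed

instantiation ordinal :: (type) wellorder
begin

lift_definition less_eq_ordinal :: "'a ordinal \<Rightarrow> 'a ordinal \<Rightarrow> bool" is "\<lambda>r s. r \<le>o s"
  by (meson ordIso_ordLeq_trans ordIso_symmetric ordLeq_ordIso_trans)

lift_definition less_ordinal :: "'a ordinal \<Rightarrow> 'a ordinal \<Rightarrow> bool" is "\<lambda>r s. r <o s"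
  by (meson ordIso_ordLess_trans ordIso_symmetric ordLess_ordIso_trans)

instance
proof
  fix x y z :: "'a ordinal"
  show "x < y \<longleftrightarrow> x \<le> y \<and> \<not> y \<le> x"
    by transfer (metis ordIso_self_iff not_ordLeq_iff_ordLess ordLess_imp_ordLeq)
  show "x \<le> x"
    by transfer (simp add: ordIso_self_iff ordLeq_reflexive)
  show "x \<le> y \<Longrightarrow> y \<le> z \<Longrightarrow> x \<le> z"
    by transfer (rule ordLeq_transitive)
  show "x \<le> y \<Longrightarrow> y \<le> x \<Longrightarrow> x = y"
    by transfer (simp add: ordIso_iff_ordLeq)
  show "x \<le> y \<or> y \<le> x"
    by transfer (simp add: ordIso_self_iff ordLeq_total)
next
  fix P :: "'a ordinal \<Rightarrow> bool" and a :: "'a ordinal"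
  assume step: "\<And>x. (\<And>y. y < x \<Longrightarrow> P y) \<Longrightarrow> P x"
  have "Well_order r \<longrightarrow> P (abs_ordinal r)" for r :: "'a rel"
  proof (induction r rule: wf_induct_rule[OF wf_ordLess])
    case (1 r)
    show ?case
    proof (rule impI, rule step)
      fix y assume r: "Well_order r" and y: "y < abs_ordinal r"
      obtain s where s: "y = abs_ordinal s" "Well_order s"
        by (rule ordinal_cases)
      have "s <o r"
        using y r s by (simp add: less_ordinal.abs_eq ordIso_self_iff)
      from 1[OF this] s show "P y"
        by blast
    qed
  qed
  moreover obtain r where "a = abs_ordinal r" "Well_order r"
    by (rule ordinal_cases)
  ultimately show "P a"
    by blast
qed

end

instantiation ordinal :: (type) zero
begin
lift_definition zero_ordinal :: "'a ordinal" is "{}"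
  by (simp add: ordIso_reflexive well_order_on_empty)
instance ..
end

lemma ordinal_zero_le [simp]: "0 \<le> (x :: 'a ordinal)"
proof transfer
  fix r :: "'a rel" assume "r =o r"
  then have "Well_order r" by (simp add: ordIso_self_iff)
  moreover have "\<not> r <o ({} :: 'a rel)"
    using \<open>Well_order r\<close> by (simp add: ordLess_iff_ordIso_Restr)
  ultimately show "({} :: 'a rel) \<le>o r"
    by (simp add: not_ordLess_iff_ordLeq)
qed

instantiation ordinal :: (type) conditionally_complete_linorder
begin

definition "inf_ordinal = (min :: 'a ordinal \<Rightarrow> _)"
definition "sup_ordinal = (max :: 'a ordinal \<Rightarrow> _)"
definition "Inf_ordinal (X :: 'a ordinal set) = (LEAST x. x \<in> X)"
definition "Sup_ordinal (X :: 'a ordinal set) = (LEAST u. \<forall>x\<in>X. x \<le> u)"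

instance
proof
  fix x y z :: "'a ordinal" and X :: "'a ordinal set"
  show "inf x y \<le> x" "inf x y \<le> y" "x \<le> y \<Longrightarrow> x \<le> z \<Longrightarrow> x \<le> inf y z"
    "x \<le> sup x y" "y \<le> sup x y" "y \<le> x \<Longrightarrow> z \<le> x \<Longrightarrow> sup y z \<le> x"
    by (simp_all add: inf_ordinal_def sup_ordinal_def)
  show "Inf X \<le> x" if "x \<in> X" "bdd_below X"
    using that by (simp add: Inf_ordinal_def Least_le)
  show "z \<le> Inf X" if "X \<noteq> {}" "\<And>x. x \<in> X \<Longrightarrow> z \<le> x"
  proof -
    have "Inf X \<in> X"
      unfolding Inf_ordinal_def by (rule LeastI_ex) (use that in blast)
    then show ?thesis by (rule that(2))
  qed
  show "x \<le> Sup X" if "x \<in> X" "bdd_above X"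
  proof -
    have "\<forall>x\<in>X. x \<le> Sup X"
      unfolding Sup_ordinal_def by (rule LeastI_ex) (use that in \<open>auto simp: bdd_above_def\<close>)
    with that show ?thesis by blast
  qed
  show "Sup X \<le> z" if "X \<noteq> {}" "\<And>x. x \<in> X \<Longrightarrow> x \<le> z"
    unfolding Sup_ordinal_def by (rule Least_le) (use that in blast)
qed

end

lemma Sup_empty_ordinal [simp]: "Sup {} = (0 :: 'a ordinal)"
  unfolding Sup_ordinal_def by (rule Least_equality) simp_all

text \<open>
  For infinite \<^typ>\<open>'a\<close>, all suprema below are taken over families indexed by at most as many
  elements as \<^typ>\<open>'a\<close> has, and these are bounded.
\<close>

lemma card_lessThan_ordinal: "|{..<b :: 'a ordinal}| \<le>o |UNIV :: 'a set|"
proof -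
  obtain r where r: "b = abs_ordinal r" "Well_order r"
    by (rule ordinal_cases)
  have "{..<b} \<subseteq> (\<lambda>a. abs_ordinal (Restr r (underS r a))) ` UNIV"
  proof
    fix y assume "y \<in> {..<b}"
    then have "y < b" by simp
    obtain s where s: "y = abs_ordinal s" "Well_order s"
      by (rule ordinal_cases)
    have "s <o r"
      using \<open>y < b\<close> r s by (simp add: less_ordinal.abs_eq ordIso_self_iff)
    then obtain a where "s =o Restr r (underS r a)"
      using r s ordLess_iff_ordIso_Restr by blast
    then have "y = abs_ordinal (Restr r (underS r a))"
      using s by (simp add: Quotient3_rel_abs[OF Quotient3_ordinal])
    then show "y \<in> (\<lambda>a. abs_ordinal (Restr r (underS r a))) ` UNIV" by blast
  qed
  then show ?thesis
    by (rule ordLeq_transitive[OF card_of_mono1 card_of_image])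
qed

lemma card_UNIV_ordinal: "\<not> |UNIV :: 'a ordinal set| \<le>o |UNIV :: 'a set|"
proof
  assume "|UNIV :: 'a ordinal set| \<le>o |UNIV :: 'a set|"
  then obtain f :: "'a ordinal \<Rightarrow> 'a" where f: "inj f"
    by (auto simp: card_of_ordLeq[symmetric])
  define w where "w = {(x, y :: 'a ordinal). x \<le> y}"
  define r where "r = dir_image w f"
  have Fw: "Field w = UNIV"
    by (auto simp: w_def Field_def)
  have "w - Id = {(x, y). x < y}"
    by (auto simp: w_def)
  then have "wf (w - Id)"
    by (simp only: wf)
  moreover have "refl w" "antisym w" "total w"
    by (auto simp: w_def refl_on_def antisym_def total_on_def)
  moreover have "trans w"
    unfolding w_def by (rule transI) simp
  ultimately have "Well_order w"
    unfolding well_order_on_def linear_order_on_def partial_order_on_def preorder_on_def Fw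
    by simp
  then have r: "Well_order r"
    unfolding r_def using f Fw by (intro Well_order_dir_image) simp_all
  define g where "g b = abs_ordinal (Restr r (underS r (f b)))" for b
  have uS: "underS r (f b) = f ` {..<b}" for b
  proof -
    have "underS r (f b) = {f x | x. f x \<noteq> f b \<and> x \<le> b}"
      using inj_eq[OF f] by (auto simp: underS_def r_def dir_image_def w_def)
    also have "\<dots> = f ` {..<b}"
      by (auto simp: inj_eq[OF f] less_le)
    finally show ?thesis .
  qed
  have wR: "Well_order (Restr r (underS r (f b)))" for b
    using r by (simp add: Well_order_Restr)
  have "strict_mono g"
  proof (rule strict_monoI)
    fix x y :: "'a ordinal" assume "x < y"
    then have "underS r (f x) < underS r (f y)"
      using f unfolding uS by (auto simp: psubset_eq inj_image_subset_iff inj_image_eq_iff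
          intro: less_trans)
    then have "Restr r (underS r (f x)) <o Restr r (underS r (f y))"
      using r by (subst ofilter_subset_ordLess[symmetric])
        (auto simp: wo_rel_def wo_rel.underS_ofilter)
    then show "g x < g y"
      using wR by (simp add: g_def less_ordinal.abs_eq ordIso_self_iff)
  qed
  then have "b \<le> g b" for b
  proof (induction b rule: less_induct)
    case (less b)
    show ?case
    proof (rule ccontr)
      assume "\<not> b \<le> g b"
      then have "g b < b" by simp
      then have "g b \<le> g (g b)" using less by simp
      moreover have "g (g b) < g b" using \<open>g b < b\<close> less.prems by (simp add: strict_monoD)
      ultimately show False by simp
    qed
  qed
  moreover have "g (abs_ordinal r) < abs_ordinal r"
  proof -
    have "Field r \<noteq> {}"
      by (simp add: r_def dir_image_Field Fw)
    then have "Restr r (underS r (f (abs_ordinal r))) <o r"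
      by (rule underS_Restr_ordLess[OF r])
    then show ?thesis
      using r wR by (simp add: g_def less_ordinal.abs_eq ordIso_self_iff)
  qed
  ultimately show False
    by (meson leD)
qed

lemma bdd_above_ordinal:
  fixes X :: "'a::infinite ordinal set"
  assumes "|X| \<le>o |UNIV :: 'a set|"
  shows "bdd_above X"
proof (rule ccontr)
  assume "\<not> bdd_above X"
  then have "UNIV = (\<Union>b\<in>X. {..<b})"
    by (auto simp: bdd_above_def not_le)
  moreover have "|\<Union>b\<in>X. {..<b}| \<le>o |UNIV :: 'a set|"
    using assms card_lessThan_ordinal infinite_UNIV
    by (intro card_of_UNION_ordLeq_infinite) auto
  ultimately show False
    using card_UNIV_ordinal[where 'a='a] by simp
qed

definition osuc :: "'a ordinal \<Rightarrow> 'a ordinal" where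
  "osuc a = (LEAST b. a < b)"

lemma less_osuc: "a < osuc (a :: 'a::infinite ordinal)"
proof -
  have "|{..<a} \<union> {a}| \<le>o |UNIV :: 'a set|"
    by (intro card_of_Un_ordLeq_infinite_Field card_lessThan_ordinal)
      (simp_all add: infinite_UNIV card_of_singl_ordLeq
          Field_card_of card_of_card_order_on)
  then have "{..<a} \<union> {a} \<noteq> UNIV"
    using card_UNIV_ordinal[where 'a='a] by force
  then have "\<exists>b. a < b"
    by (auto simp: not_less le_less)
  then show ?thesis
    unfolding osuc_def by (rule LeastI_ex)
qed

text \<open>
  In the recursions on the second argument below, one supremum over all smaller ordinals covers both
  the successor and the limit clause of the usual definition.
\<close>

function oadd :: "'a ordinal \<Rightarrow> 'a ordinal \<Rightarrow> 'a ordinal" where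
  "oadd a b = (if b = 0 then a else (SUP c\<in>{..<b}. osuc (oadd a c)))"
  by pat_completeness auto
termination
  by (relation "inv_image {(x, y). x < y} snd") (auto intro: wf)

function omult :: "'a ordinal \<Rightarrow> 'a ordinal \<Rightarrow> 'a ordinal" where
  "omult a b = (SUP c\<in>{..<b}. oadd (omult a c) a)"
  by pat_completeness auto
termination
  by (relation "inv_image {(x, y). x < y} snd") (auto intro: wf)

function oexp :: "'a ordinal \<Rightarrow> 'a ordinal \<Rightarrow> 'a ordinal" where
  "oexp a b = (if b = 0 then osuc 0 else (SUP c\<in>{..<b}. omult (oexp a c) a))"
  by pat_completeness auto
termination
  by (relation "inv_image {(x, y). x < y} snd") (auto intro: wf)

declare oadd.simps [simp del] omult.simps [simp del] oexp.simps [simp del]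

definition omega :: "'a ordinal" where
  "omega = (SUP n. (osuc ^^ n) 0)"


section \<open>Ordinal height\<close>

definition ordinal_rank :: "'a rel \<Rightarrow> 'a \<Rightarrow> 'a ordinal" where
  "ordinal_rank R = wfrec R (\<lambda>\<rho> z.
     if \<forall>y. (y, z) \<notin> R then 0 else (SUP y\<in>{y. (y, z) \<in> R}. osuc (\<rho> y)))"

lemma ordinal_rank_rec:
  assumes "wf R"
  shows "ordinal_rank R z =
    (if \<forall>y. (y, z) \<notin> R then 0 else (SUP y\<in>{y. (y, z) \<in> R}. osuc (ordinal_rank R y)))"
proof -
  have "(\<lambda>y. osuc (cut (ordinal_rank R) R z y)) ` {y. (y, z) \<in> R}
      = (\<lambda>y. osuc (ordinal_rank R y)) ` {y. (y, z) \<in> R}"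
    by (auto simp: cut_apply intro!: image_cong)
  then show ?thesis
    unfolding ordinal_rank_def by (subst wfrec[OF assms]) simp
qed

definition ordinal_height :: "'a set \<Rightarrow> 'a rel \<Rightarrow> 'a ordinal" where
  "ordinal_height A R = (SUP x\<in>A. ordinal_rank R x)"


section \<open>Automatic structures\<close>

record ('q, 'c) automaton =
  states :: "'q set"
  initial :: 'q
  transitions :: "('q \<times> 'c \<times> 'q) set"
  final :: "'q set"

definition finite_automaton :: "'c set \<Rightarrow> ('q, 'c) automaton \<Rightarrow> bool" where
  "finite_automaton \<Gamma> M \<longleftrightarrow>
     finite (states M) \<and> initial M \<in> states M \<and> final M \<subseteq> states M \<and>
     transitions M \<subseteq> states M \<times> \<Gamma> \<times> states M"

definition accepts :: "('q, 'c) automaton \<Rightarrow> 'c list \<Rightarrow> bool" where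
  "accepts M w \<longleftrightarrow> (\<exists>qs. length qs = length w + 1 \<and> qs ! 0 = initial M \<and>
     (\<forall>i < length w. (qs ! i, w ! i, qs ! (i + 1)) \<in> transitions M) \<and>
     qs ! length w \<in> final M)"

text \<open>Taking the states to be natural numbers is no restriction, as there are finitely many.\<close>

definition regular_language :: "'c set \<Rightarrow> 'c list set \<Rightarrow> bool" where
  "regular_language \<Gamma> L \<longleftrightarrow> finite \<Gamma> \<and>
     (\<exists>M :: (nat, 'c) automaton. finite_automaton \<Gamma> M \<and> L = {w. accepts M w})"

text \<open>An \<open>n\<close>-tuple is a list of length \<open>n\<close>; the padding symbol is \<^const>\<open>None\<close>.\<close>

definition convolution :: "'c list list \<Rightarrow> 'c option list list" where
  "convolution ws =
     map (\<lambda>k. map (\<lambda>w. if k < length w then Some (w ! k) else None) ws)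
       [0..<Max (insert 0 (length ` set ws))]"

definition conv_alphabet :: "'c set \<Rightarrow> nat \<Rightarrow> 'c option list set" where
  "conv_alphabet \<Sigma> n = {\<sigma>. length \<sigma> = n \<and> set \<sigma> \<subseteq> insert None (Some ` \<Sigma>)}"

definition regular_relation :: "'c set \<Rightarrow> nat \<Rightarrow> 'c list list set \<Rightarrow> bool" where
  "regular_relation \<Sigma> n R \<longleftrightarrow>
     R \<subseteq> {ws. length ws = n \<and> set ws \<subseteq> lists \<Sigma>} \<and>
     regular_language (conv_alphabet \<Sigma> n) (convolution ` R)"

text \<open>A relational structure is a universe together with a list of relations, each with its arity.\<close>

type_synonym 'u struct = "'u set \<times> (nat \<times> 'u list set) list"

definition is_struct :: "'u struct \<Rightarrow> bool" where
  "is_struct S \<longleftrightarrow>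
     (\<forall>(n, R) \<in> set (snd S). R \<subseteq> {xs. length xs = n \<and> set xs \<subseteq> fst S})"

definition struct_iso :: "'u struct \<Rightarrow> 'v struct \<Rightarrow> bool" where
  "struct_iso S T \<longleftrightarrow> (\<exists>f. bij_betw f (fst S) (fst T) \<and>
     list_all2 (\<lambda>(n, R) (m, Q). n = m \<and>
         (\<forall>xs. length xs = n \<longrightarrow> set xs \<subseteq> fst S \<longrightarrow> (xs \<in> R \<longleftrightarrow> map f xs \<in> Q)))
       (snd S) (snd T))"

definition automatic_over :: "'c set \<Rightarrow> 'c list struct \<Rightarrow> bool" where
  "automatic_over \<Sigma> S \<longleftrightarrow> finite \<Sigma> \<and> is_struct S \<and> regular_language \<Sigma> (fst S) \<and>
     (\<forall>(n, R) \<in> set (snd S). regular_relation \<Sigma> n R)"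

text \<open>Taking the letters to be natural numbers is no restriction, as alphabets are finite.\<close>

definition automatic :: "'u struct \<Rightarrow> bool" where
  "automatic S \<longleftrightarrow> is_struct S \<and>
     (\<exists>(\<Sigma> :: nat set) T. automatic_over \<Sigma> T \<and> struct_iso S T)"

definition order_struct :: "'u set \<Rightarrow> 'u rel \<Rightarrow> 'u struct" where
  "order_struct A le = (A, [(2, {[x, y] | x y. (x, y) \<in> le})])"

end

theory Submission
  imports Defs "HOL-Library.Multiset_Order" "HOL-Library.Countable_Set" "HOL-Library.Sublist"
begin

text \<open>
  The ordinals below \<open>\<omega>\<^sup>\<omega>\<close> are represented by finite multisets of natural numbers: the multiset
  of exponents of the Cantor normal form.  The order of ordinals becomes the multiset order and
  the natural sum becomes the sum of multisets.

  If an automatic well-founded partial order had height at least \<open>\<omega>\<^sup>\<omega>\<close>, choose for each \<open>n > 0\<close> a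
  minimal \<open>u\<close> of rank at least \<open>\<omega>\<^sup>n\<close>.  Up to finitely many elements, the part below \<open>u\<close> is the
  union of the finitely many sets \<open>X v u\<close> of words below \<open>u\<close> that properly extend \<open>v\<close>, where
  \<open>|v| = |u|\<close>.  As \<open>\<omega>\<^sup>n\<close> is indecomposable for the natural sum, one of them has height \<open>\<omega>\<^sup>n\<close>.  But the
  order on \<open>X v u\<close> is determined up to isomorphism by the sets of states that the automaton can reach on
  the convolutions of \<open>(v, v)\<close> and \<open>(v, u)\<close>, so only finitely many heights can occur.

  Conversely, the multisets up to \<open>M\<close>, written as descending words, form an automatic
  well-order under the lexicographic order, in which \<open>M\<close> has the rank it represents.
\<close>

section \<open>Ordinals below \<open>\<omega>\<^sup>\<omega>\<close> as multisets\<close>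

lemma bdd_above_ordinal_image:
  fixes g :: "'b \<Rightarrow> 'a::infinite ordinal"
  assumes "|X| \<le>o |UNIV :: 'a set|"
  shows "bdd_above (g ` X)"
  by (rule bdd_above_ordinal) (rule ordLeq_transitive[OF card_of_image assms])

lemma bdd_above_ordinal_image_self:
  fixes g :: "'a \<Rightarrow> 'a::infinite ordinal"
  shows "bdd_above (g ` X)"
  by (rule bdd_above_ordinal_image) (simp add: card_of_mono1)

lemma bdd_above_ordinal_countable:
  fixes X :: "'a::infinite ordinal set"
  assumes "countable X"
  shows "bdd_above X"
proof (rule bdd_above_ordinal)
  have "|X| \<le>o |UNIV :: nat set|"
    using assms unfolding countable_def by (auto simp: card_of_ordLeq[symmetric])
  also have "|UNIV :: nat set| \<le>o |UNIV :: 'a set|"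
    using infinite_UNIV infinite_iff_card_of_nat by blast
  finally (ordLeq_transitive) show "|X| \<le>o |UNIV :: 'a set|" .
qed

lemma osuc_le_iff [simp]: "osuc a \<le> b \<longleftrightarrow> a < b" for a :: "'a::infinite ordinal"
  by (metis less_osuc order.strict_trans2 osuc_def Least_le)

lemma ordinal_not_less_zero [simp]: "\<not> a < (0 :: 'a ordinal)"
  by (simp add: not_less)

lemma ordinal_rank_le_iff:
  fixes b :: "'a::infinite ordinal"
  assumes "wf R"
  shows "ordinal_rank R x \<le> b \<longleftrightarrow> (\<forall>y. (y, x) \<in> R \<longrightarrow> ordinal_rank R y < b)"
  by (subst ordinal_rank_rec[OF assms])
    (auto simp: cSUP_le_iff bdd_above_ordinal_image_self)

lemma ordinal_rank_less:
  assumes "wf R" "(y, x) \<in> R"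
  shows "ordinal_rank R y < (ordinal_rank R x :: 'a::infinite ordinal)"
  using ordinal_rank_le_iff[OF assms(1), of x "ordinal_rank R x"] assms(2) by blast

text \<open>Ranks leave no gaps: as \<open>b\<close> does not bound the rank of \<open>x\<close>,
  some predecessor has rank at least \<open>b\<close>. If that rank exceeds \<open>b\<close>, the
  induction hypothesis applies to it, and transitivity brings the witness below
  \<open>x\<close>.\<close>

lemma ordinal_rank_below:
  fixes b :: "'a::infinite ordinal"
  assumes "wf R" "trans R" "b < ordinal_rank R x"
  shows "\<exists>y. (y, x) \<in> R \<and> ordinal_rank R y = b"
  using assms(1,3)
proof (induction x rule: wf_induct_rule)
  case (less x)
  then obtain y where y: "(y, x) \<in> R" "b \<le> ordinal_rank R y"
    using ordinal_rank_le_iff[OF assms(1), of x b] by (auto simp: not_le[symmetric])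
  then show ?case
    using less.IH[OF y(1)] transD[OF assms(2) _ y(1)] y by (auto simp: order_le_less)
qed

text \<open>A rank depends only on what lies below the element, so it suffices that the relations
  agree below points of \<open>A\<close> and that \<open>A\<close> is closed downwards.\<close>

lemma ordinal_rank_cong:
  fixes R S :: "'a::infinite rel"
  assumes "wf R" "wf S"
    and down: "\<And>x y. x \<in> A \<Longrightarrow> (y, x) \<in> R \<Longrightarrow> y \<in> A \<and> (y, x) \<in> S"
    and up: "\<And>x y. x \<in> A \<Longrightarrow> (y, x) \<in> S \<Longrightarrow> (y, x) \<in> R"
    and "x \<in> A"
  shows "ordinal_rank R x = ordinal_rank S x"
  using assms(1,5)
proof (induction x rule: wf_induct_rule)
  case (less x)
  have "ordinal_rank R x \<le> b \<longleftrightarrow> ordinal_rank S x \<le> b" for b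
    unfolding ordinal_rank_le_iff[OF assms(1)] ordinal_rank_le_iff[OF assms(2)]
    using less down up by (metis (no_types))
  then show ?case
    by (meson order_antisym order_refl)
qed

text \<open>Suprema are accessible only through their upper bounds, so most equations between
  ordinals below are proved by comparing upper bounds.\<close>

lemma eqI_upper_bounds: "(\<And>b. x \<le> b \<longleftrightarrow> y \<le> b) \<Longrightarrow> x = (y :: 'b::order)"
  by (meson order_antisym order_refl)

text \<open>
  Ranks of a relation on \<^typ>\<open>'a\<close> are ordinals of type \<^typ>\<open>'a ordinal\<close>; so that multisets have ranks
  in this type too, they are coded as elements of the infinite type \<^typ>\<open>'a\<close>.
\<close>

definition mset_code :: "nat multiset \<Rightarrow> 'a::infinite" where
  "mset_code = (SOME f. inj f)"

lemma inj_mset_code: "inj (mset_code :: nat multiset \<Rightarrow> 'a::infinite)"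
proof -
  obtain g :: "nat \<Rightarrow> 'a" where g: "inj g"
    using infinite_countable_subset[OF infinite_UNIV] by auto
  have "inj (g \<circ> to_nat \<circ> sorted_list_of_multiset)"
    using g by (intro inj_compose) (auto intro: inj_on_inverseI[of _ mset])
  then show ?thesis
    unfolding mset_code_def by (rule someI[of inj])
qed

lemma mset_code_eq_iff [simp]: "(mset_code M :: 'a::infinite) = mset_code N \<longleftrightarrow> M = N"
  by (rule inj_eq[OF inj_mset_code])

section \<open>The ordinals represented by multisets\<close>

definition code_less :: "'a::infinite rel" where
  "code_less = {(mset_code N, mset_code M) | N M. N < M}"

lemma code_less_iff [simp]: "(mset_code N :: 'a::infinite, mset_code M) \<in> code_less \<longleftrightarrow> N < M"
  by (auto simp: code_less_def)

lemma wf_code_less: "wf (code_less :: 'a::infinite rel)"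
proof -
  have "wf (map_prod mset_code (mset_code :: _ \<Rightarrow> 'a) ` {(N, M). N < M})"
    by (rule wf_map_prod_image[OF wf_less_multiset inj_mset_code])
  also have "map_prod mset_code (mset_code :: _ \<Rightarrow> 'a) ` {(N, M). N < M} = code_less"
    by (auto simp: code_less_def)
  finally show ?thesis .
qed

lemma trans_code_less: "trans (code_less :: 'a::infinite rel)"
  by (rule transI) (auto simp: code_less_def)

text \<open>If n1 \<ge> ... \<ge> nk are the elements of \<open>M\<close>, this is \<omega>^n1 + ...
  + \<omega>^nk. Defining it as a rank postpones all ordinal arithmetic; \<open>oadd\<close>,
  \<open>omult\<close> and \<open>oexp\<close> are matched with it afterwards.\<close>

definition mset_ord :: "nat multiset \<Rightarrow> 'a::infinite ordinal" where
  "mset_ord M = ordinal_rank code_less (mset_code M)"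

lemma mset_ord_less_imp: "N < M \<Longrightarrow> (mset_ord N :: 'a::infinite ordinal) < mset_ord M"
  unfolding mset_ord_def by (rule ordinal_rank_less[OF wf_code_less]) simp

lemma mset_ord_less_iff [simp]: "(mset_ord N :: 'a::infinite ordinal) < mset_ord M \<longleftrightarrow> N < M"
  by (metis mset_ord_less_imp not_less_iff_gr_or_eq)

lemma mset_ord_le_iff [simp]: "(mset_ord N :: 'a::infinite ordinal) \<le> mset_ord M \<longleftrightarrow> N \<le> M"
  by (simp add: not_less[symmetric])

text \<open>The represented ordinals form an initial segment because ranks leave no gaps. This turns
  suprema over smaller ordinals, as in the recursions for the arithmetic operations, into suprema
  over smaller multisets.\<close>

lemma less_mset_ord_iff: "x < (mset_ord M :: 'a::infinite ordinal) \<longleftrightarrow> (\<exists>N<M. x = mset_ord N)"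
proof
  assume "x < mset_ord M"
  then obtain y where "(y, mset_code M) \<in> code_less" "ordinal_rank code_less y = x"
    unfolding mset_ord_def using ordinal_rank_below[OF wf_code_less trans_code_less] by blast
  then show "\<exists>N<M. x = mset_ord N"
    by (auto simp: code_less_def mset_ord_def)
qed auto

lemma lessThan_mset_ord: "{..<mset_ord M :: 'a::infinite ordinal} = mset_ord ` {..<M}"
  by (auto simp: less_mset_ord_iff)

lemma mset_ord_le_iff_all:
  "(mset_ord M :: 'a::infinite ordinal) \<le> b \<longleftrightarrow> (\<forall>N<M. mset_ord N < b)"
proof (intro iffI allI impI)
  fix N assume "mset_ord M \<le> b" "N < M"
  then show "mset_ord N < b" by (metis mset_ord_less_iff order.strict_trans2)
next
  assume *: "\<forall>N<M. mset_ord N < b"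
  show "mset_ord M \<le> b"
  proof (rule ccontr)
    assume "\<not> mset_ord M \<le> b"
    then obtain N where "N < M" "b = mset_ord N" using less_mset_ord_iff[of b M] by auto
    with * show False by auto
  qed
qed

lemma mset_ord_empty [simp]: "mset_ord {#} = (0 :: 'a::infinite ordinal)"
  by (rule order_antisym) (auto simp: mset_ord_le_iff_all)

section \<open>Ordinal arithmetic on multisets\<close>

lemma less_replicate_msetI:
  fixes K :: "nat multiset"
  assumes "\<And>x. x \<in># K \<Longrightarrow> x \<le> n" "count K n < k"
  shows "K < replicate_mset k n"
  unfolding less_multiset\<^sub>H\<^sub>O
proof (intro conjI allI impI)
  show "K \<noteq> replicate_mset k n" using assms(2) by auto
  fix y assume y: "count (replicate_mset k n) y < count K y"
  then have "y \<le> n" by (intro assms(1)) (simp add: count_greater_zero_iff[symmetric] del: count_greater_zero_iff)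
  moreover have "y \<noteq> n" using y assms(2) by auto
  ultimately show "\<exists>x>y. count K x < count (replicate_mset k n) x"
    using assms(2) by (intro exI[of _ n]) auto
qed

text \<open>This mirrors the fact that an ordinal below a + b is below a or of the form a + c with c
  < b. No element of \<open>K\<close> exceeds \<open>n\<close>, so with fewer than \<open>k\<close>
  copies of \<open>n\<close> it lies below \<open>replicate_mset k n\<close>; otherwise these copies
  can be cancelled.\<close>

lemma less_replicate_plus_cases:
  fixes K :: "nat multiset"
  assumes "K < replicate_mset k n + N" "N \<le> {#n#}"
  shows "K < replicate_mset k n \<or> (\<exists>N'<N. K = replicate_mset k n + N')"
proof (cases "count K n < k")
  case True
  have "K < replicate_mset (Suc k) n"
    using assms by (metis add_left_mono order.strict_trans2 replicate_mset_Suc add_mset_add_single)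
  have "x \<le> n" if "x \<in># K" for x
  proof (rule ccontr)
    assume "\<not> x \<le> n"
    then have "replicate_mset (Suc k) n < K"
      using that by (intro ex_gt_imp_less_multiset exI[of _ x]) (auto split: if_splits)
    then show False using \<open>K < replicate_mset (Suc k) n\<close> by simp
  qed
  then show ?thesis using True less_replicate_msetI by blast
next
  case False
  then have "replicate_mset k n \<subseteq># K"
    by (simp add: count_le_replicate_mset_subset_eq[symmetric])
  then obtain N' where "K = replicate_mset k n + N'"
    by (auto simp: subset_mset.le_iff_add)
  then show ?thesis using assms(1) by auto
qed

text \<open>The natural sum agrees with the ordinal sum here because no exponent on the right
  exceeds the exponent \<open>n\<close> on the left, so nothing is absorbed.\<close>

lemma oadd_mset_ord:
  fixes N :: "nat multiset"
  assumes "N \<le> {#n#}"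
  shows "oadd (mset_ord (replicate_mset k n)) (mset_ord N)
    = (mset_ord (replicate_mset k n + N) :: 'a::infinite ordinal)"
  using assms
proof (induction N rule: less_induct)
  case (less N)
  show ?case
  proof (cases "N = {#}")
    case True
    then show ?thesis by (simp add: oadd.simps)
  next
    case False
    then have ne: "mset_ord N \<noteq> (0 :: 'a ordinal)"
      by (metis le_multiset_empty_left mset_ord_less_iff ordinal_not_less_zero)
    then have ne': "{..<mset_ord N :: 'a ordinal} \<noteq> {}"
      by (metis lessThan_iff empty_iff ordinal_zero_le order_le_less)
    show ?thesis
    proof (rule eqI_upper_bounds)
      fix b :: "'a ordinal"
      have "oadd (mset_ord (replicate_mset k n)) (mset_ord N) \<le> b
        \<longleftrightarrow> (\<forall>c<mset_ord N. oadd (mset_ord (replicate_mset k n)) c < b)"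
        using ne ne' by (subst oadd.simps)
          (auto simp: cSUP_le_iff bdd_above_ordinal_image[OF card_lessThan_ordinal])
      also have "\<dots> \<longleftrightarrow> (\<forall>N'<N. mset_ord (replicate_mset k n + N') < b)"
        unfolding less_mset_ord_iff
        using less.IH[OF _ order.trans[OF order_less_imp_le less.prems]] by force
      also have "\<dots> \<longleftrightarrow> (\<forall>K<replicate_mset k n + N. mset_ord K < b)"
      proof (intro iffI allI impI)
        fix K assume *: "\<forall>N'<N. mset_ord (replicate_mset k n + N') < b"
          and K: "K < replicate_mset k n + N"
        have "mset_ord K \<le> (mset_ord (replicate_mset k n) :: 'a ordinal)
            \<or> (\<exists>N'<N. K = replicate_mset k n + N')"
          using less_replicate_plus_cases[OF K less.prems] by auto
        \<comment> \<open>As \<open>N\<close> is nonempty, the empty multiset is an admissible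
          \<open>N'\<close>; it covers everything up to the first summand.\<close>
        moreover have "mset_ord (replicate_mset k n) < b"
          using *[rule_format, of "{#}"] False by simp
        ultimately show "mset_ord K < b" using * by (metis order.strict_trans1)
      qed auto
      finally show "oadd (mset_ord (replicate_mset k n)) (mset_ord N) \<le> b
        \<longleftrightarrow> mset_ord (replicate_mset k n + N) \<le> b"
        by (simp add: mset_ord_le_iff_all[of "_ + _"])
    qed
  qed
qed

text \<open>The natural number k is \<omega>^0 * k, hence k copies of the exponent 0.\<close>

lemma osuc_funpow_zero: "(osuc ^^ k) 0 = (mset_ord (replicate_mset k 0) :: 'a::infinite ordinal)"
proof (induction k)
  case (Suc k)
  have "osuc (mset_ord (replicate_mset k 0)) = (mset_ord (replicate_mset (Suc k) 0) :: 'a ordinal)"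
  proof (rule eqI_upper_bounds)
    fix b :: "'a ordinal"
    have "mset_ord (replicate_mset (Suc k) 0) \<le> b
      \<longleftrightarrow> (\<forall>K<replicate_mset (Suc k) 0. mset_ord K < b)"
      by (rule mset_ord_le_iff_all)
    also have "\<dots> \<longleftrightarrow> mset_ord (replicate_mset k 0) < b"
    proof (intro iffI allI impI)
      fix K :: "nat multiset" assume b: "mset_ord (replicate_mset k 0) < b"
        and K: "K < replicate_mset (Suc k) 0"
      have "K \<le> replicate_mset k 0"
        using less_replicate_plus_cases[of K k 0 "{#0#}"] K by (auto simp: not_less)
      then show "mset_ord K < b"
        using b by (meson mset_ord_le_iff order.strict_trans1)
    qed (simp add: le_multiset_right_total)
    finally show "osuc (mset_ord (replicate_mset k 0)) \<le> b
        \<longleftrightarrow> mset_ord (replicate_mset (Suc k) 0) \<le> b" by simp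
  qed
  then show ?case using Suc by simp
qed simp

lemma replicate_mset_less_iff [simp]:
  "replicate_mset k n < replicate_mset l n \<longleftrightarrow> k < l" for n :: nat
proof -
  have *: "replicate_mset k n < replicate_mset l n" if "k < l" for k l
    using that by (intro less_replicate_msetI) (auto split: if_splits)
  show ?thesis using *[of k l] *[of l k] by (metis less_asym linorder_neqE_nat order_less_irrefl)
qed

text \<open>No element of such an \<open>M\<close> exceeds \<open>n\<close>, so one more copy of
  \<open>n\<close> than \<open>M\<close> contains is enough. In terms of ordinals, \<omega>^(n+1) is
  the supremum of all \<omega>^n * k.\<close>

lemma less_single_Suc_iff: "M < {#Suc n#} \<longleftrightarrow> (\<exists>k. M < replicate_mset k n)" for M :: "nat multiset"
proof
  assume "M < {#Suc n#}"
  then show "\<exists>k. M < replicate_mset k n"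
    by (intro exI[of _ "Suc (count M n)"] less_replicate_msetI) auto
next
  assume "\<exists>k. M < replicate_mset k n"
  then obtain k where "M < replicate_mset k n" by blast
  also have "replicate_mset k n < {#Suc n#}" by (auto split: if_splits)
  finally show "M < {#Suc n#}" .
qed

lemma omega_eq: "omega = (mset_ord {#1#} :: 'a::infinite ordinal)"
proof (rule eqI_upper_bounds)
  fix b :: "'a ordinal"
  have "omega \<le> b \<longleftrightarrow> (\<forall>k. mset_ord (replicate_mset k 0) \<le> b)"
    unfolding omega_def osuc_funpow_zero
    by (subst cSUP_le_iff) (auto intro: bdd_above_ordinal_countable)
  also have "\<dots> \<longleftrightarrow> (\<forall>k. \<forall>M<replicate_mset k 0. mset_ord M < b)"
    by (simp add: mset_ord_le_iff_all)
  also have "\<dots> \<longleftrightarrow> mset_ord {#1#} \<le> b"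
    unfolding mset_ord_le_iff_all[of "{#1#}"] using less_single_Suc_iff[of _ 0] by auto
  finally show "omega \<le> b \<longleftrightarrow> mset_ord {#1#} \<le> b" .
qed

lemma lessThan_osuc_funpow:
  "{..<mset_ord (replicate_mset k 0) :: 'a::infinite ordinal}
    = (\<lambda>i. mset_ord (replicate_mset i 0)) ` {..<k}"
proof -
  have "\<exists>i<k. M = replicate_mset i 0" if "M < replicate_mset k 0" for M :: "nat multiset"
    using that
  proof (induction k)
    case (Suc k)
    then have "M < replicate_mset k 0 \<or> M = replicate_mset k 0"
      using less_replicate_plus_cases[of M k 0 "{#0#}"] by auto
    then show ?case using Suc.IH less_Suc_eq by auto
  qed simp
  then have "{..<replicate_mset k 0} = (\<lambda>i. replicate_mset i (0 :: nat)) ` {..<k}"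
    by auto
  then show ?thesis unfolding lessThan_mset_ord by (simp add: image_image)
qed

lemma lessThan_omega:
  "{..<omega :: 'a::infinite ordinal} = range (\<lambda>i. mset_ord (replicate_mset i 0))"
proof -
  have "{..<omega :: 'a ordinal} = mset_ord ` {..<{#Suc 0#}}"
    by (simp add: omega_eq lessThan_mset_ord)
  also have "\<dots> = (\<Union>k. {..<mset_ord (replicate_mset k 0)})"
    unfolding lessThan_mset_ord using less_single_Suc_iff[of _ 0] by blast
  also have "\<dots> = range (\<lambda>i. mset_ord (replicate_mset i 0))"
    unfolding lessThan_osuc_funpow by blast
  finally show ?thesis .
qed

lemma omult_mset_ord_finite:
  "omult (mset_ord {#n#}) (mset_ord (replicate_mset k 0))
    = (mset_ord (replicate_mset k n) :: 'a::infinite ordinal)"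
proof (induction k rule: less_induct)
  case (less k)
  have "omult (mset_ord {#n#}) (mset_ord (replicate_mset k 0))
    = (SUP i\<in>{..<k}. oadd (omult (mset_ord {#n#}) (mset_ord (replicate_mset i 0))) (mset_ord {#n#} :: 'a ordinal))"
    by (subst omult.simps) (simp add: lessThan_osuc_funpow image_image)
  also have "\<dots> = (SUP i\<in>{..<k}. mset_ord (replicate_mset (Suc i) n))"
    using less by (intro SUP_cong) (auto simp: oadd_mset_ord)
  also have "\<dots> = mset_ord (replicate_mset k n)"
  \<comment> \<open>The supremum is attained at the last index; for \<open>k = 0\<close> it is the
    empty supremum, which is 0.\<close>
  proof (cases k)
    case (Suc m)
    show ?thesis
      by (rule cSup_eq_maximum) (auto simp: Suc image_iff not_less[symmetric] simp del: replicate_mset_Suc)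
  qed simp
  finally show ?case .
qed

lemma omult_mset_ord_omega:
  "omult (mset_ord {#n#}) omega = (mset_ord {#Suc n#} :: 'a::infinite ordinal)"
proof (rule eqI_upper_bounds)
  fix b :: "'a ordinal"
  have "omult (mset_ord {#n#}) omega
    = (SUP k. mset_ord (replicate_mset (Suc k) n) :: 'a ordinal)"
    by (subst omult.simps)
      (simp add: lessThan_omega image_image omult_mset_ord_finite oadd_mset_ord)
  then have "omult (mset_ord {#n#}) omega \<le> b \<longleftrightarrow> (\<forall>k. mset_ord (replicate_mset (Suc k) n) \<le> b)"
    by (simp add: cSUP_le_iff bdd_above_ordinal_countable del: replicate_mset_Suc)
  also have "\<dots> \<longleftrightarrow> (\<forall>k. mset_ord (replicate_mset k n) \<le> b)"
    by (metis mset_ord_empty not0_implies_Suc ordinal_zero_le replicate_mset_0)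
  also have "\<dots> \<longleftrightarrow> mset_ord {#Suc n#} \<le> b"
    by (auto simp: mset_ord_le_iff_all[of "replicate_mset _ _"] mset_ord_le_iff_all[of "{#_#}"]
        less_single_Suc_iff simp del: mset_lt_single_right_iff)
  finally show "omult (mset_ord {#n#}) omega \<le> b \<longleftrightarrow> mset_ord {#Suc n#} \<le> b" .
qed

lemma oexp_omega_finite:
  "oexp omega (mset_ord (replicate_mset k 0)) = (mset_ord {#k#} :: 'a::infinite ordinal)"
proof (induction k rule: less_induct)
  case (less k)
  show ?case
  proof (cases k)
    case 0
    then show ?thesis using osuc_funpow_zero[of 1] by (simp add: oexp.simps)
  next
    case (Suc m)
    have "mset_ord (replicate_mset k 0) \<noteq> (0 :: 'a ordinal)"
      using mset_ord_less_iff[of "{#}" "replicate_mset k 0", where 'a='a] Suc by auto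
    then have "oexp omega (mset_ord (replicate_mset k 0))
      = (SUP i\<in>{..<k}. omult (oexp omega (mset_ord (replicate_mset i 0))) (omega :: 'a ordinal))"
      by (subst oexp.simps) (simp add: lessThan_osuc_funpow image_image)
    also have "\<dots> = (SUP i\<in>{..<k}. mset_ord {#Suc i#})"
      using less by (intro SUP_cong) (auto simp: omult_mset_ord_omega)
    also have "\<dots> = mset_ord {#k#}"
      by (rule cSup_eq_maximum) (auto simp: Suc)
    finally show ?thesis .
  qed
qed

lemma less_oexp_omega_omega_iff:
  "x < (oexp omega omega :: 'a::infinite ordinal) \<longleftrightarrow> (\<exists>n. x < mset_ord {#n#})"
proof -
  have "omega \<noteq> (0 :: 'a ordinal)"
    using lessThan_omega[where 'a='a] by (metis UNIV_not_empty image_is_empty lessThan_iff empty_iff ordinal_not_less_zero subsetI subset_empty)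
  then have "oexp omega omega = (SUP k. mset_ord {#Suc k#} :: 'a ordinal)"
    by (subst oexp.simps) (simp add: lessThan_omega image_image oexp_omega_finite omult_mset_ord_omega)
  then have "x < oexp omega omega \<longleftrightarrow> (\<exists>k. x < mset_ord {#Suc k#})"
    by (simp add: less_cSUP_iff bdd_above_ordinal_countable)
  also have "\<dots> \<longleftrightarrow> (\<exists>n. x < mset_ord {#n#})"
    by (metis lessI mset_lt_single_iff mset_ord_less_iff order.strict_trans)
  finally show ?thesis .
qed

text \<open>A finite multiset lies below the single exponent \<open>n\<close> once \<open>n\<close>
  exceeds all its elements; conversely, everything below a represented ordinal is represented. From
  here on \<omega>^\<omega> is handled through multisets.\<close>

lemma less_oexp_omega_omega_iff_mset_ord:
  "x < (oexp omega omega :: 'a::infinite ordinal) \<longleftrightarrow> (\<exists>M. x = mset_ord M)"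
proof
  assume "\<exists>M. x = mset_ord M"
  then obtain M where x: "x = mset_ord M" by blast
  obtain n where "\<And>i. i \<in># M \<Longrightarrow> i < n"
    using finite_nat_set_iff_bounded[of "set_mset M"] by auto
  then have "M < {#n#}" by simp
  then show "x < oexp omega omega"
    unfolding x less_oexp_omega_omega_iff mset_ord_less_iff by blast
qed (auto simp: less_oexp_omega_omega_iff less_mset_ord_iff)

section \<open>Regular languages and convolutions\<close>

definition step_set :: "('q, 'c) automaton \<Rightarrow> 'q set \<Rightarrow> 'c \<Rightarrow> 'q set" where
  "step_set M S c = {q. \<exists>p\<in>S. (p, c, q) \<in> transitions M}"

text \<open>A run may start anywhere in a set \<open>S\<close>: a nondeterministic automaton passes
  from one state to a set of states, and the induction on the word needs this generality.\<close>

lemma ex_run_iff: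
  "(\<exists>qs. length qs = length w + 1 \<and> qs ! 0 \<in> S \<and>
     (\<forall>i < length w. (qs ! i, w ! i, qs ! (i + 1)) \<in> transitions M) \<and> qs ! length w \<in> F)
   \<longleftrightarrow> foldl (step_set M) S w \<inter> F \<noteq> {}" (is "(\<exists>qs. ?run w S qs) \<longleftrightarrow> _")
proof (induction w arbitrary: S)
  case Nil
  show ?case
  proof
    assume "foldl (step_set M) S [] \<inter> F \<noteq> {}"
    then obtain q where "q \<in> S \<inter> F" by auto
    then show "\<exists>qs. ?run [] S qs" by (intro exI[of _ "[q]"]) auto
  qed auto
next
  case (Cons c w)
  have "(\<exists>qs. ?run (c # w) S qs) \<longleftrightarrow> (\<exists>qs. ?run w (step_set M S c) qs)"
  proof
    assume "\<exists>qs. ?run (c # w) S qs"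
    then obtain qs where qs: "?run (c # w) S qs" by blast
    then obtain q qs' where [simp]: "qs = q # qs'" by (cases qs) auto
    have "(qs ! i, (c # w) ! i, qs ! (i + 1)) \<in> transitions M" if "i < Suc (length w)" for i
      using qs that by simp
    from this[of 0] this[of "Suc _"] have "?run w (step_set M S c) qs'"
      using qs by (auto simp: step_set_def)
    then show "\<exists>qs. ?run w (step_set M S c) qs" by blast
  next
    assume "\<exists>qs. ?run w (step_set M S c) qs"
    then obtain qs where qs: "?run w (step_set M S c) qs" by blast
    then obtain q where "q \<in> S" "(q, c, qs ! 0) \<in> transitions M"
      by (auto simp: step_set_def)
    then have "?run (c # w) S (q # qs)"
      using qs by (auto simp: nth_Cons split: nat.split)
    then show "\<exists>qs. ?run (c # w) S qs" by blast
  qed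
  then show ?case using Cons.IH by simp
qed

lemma accepts_iff: "accepts M w \<longleftrightarrow> foldl (step_set M) {initial M} w \<inter> final M \<noteq> {}"
  using ex_run_iff[of w "{initial M}" M "final M"] by (simp add: accepts_def)

lemma foldl_step_set_subset:
  assumes "finite_automaton \<Gamma> M" "S \<subseteq> states M"
  shows "foldl (step_set M) S w \<subseteq> states M"
  using assms(2)
proof (induction w arbitrary: S)
  case (Cons c w)
  have "step_set M S c \<subseteq> states M"
    using assms(1) by (auto simp: step_set_def finite_automaton_def)
  then show ?case using Cons.IH by simp
qed simp

definition derivative :: "'c \<Rightarrow> 'c list set \<Rightarrow> 'c list set" where
  "derivative c L = {w. c # w \<in> L}"

lemma derivative_simps [simp]:
  "derivative c {} = {}" "derivative c {[]} = {}"
  by (auto simp: derivative_def)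

lemma foldl_derivative: "foldl (\<lambda>L c. derivative c L) L w = {x. w @ x \<in> L}"
  by (induction w arbitrary: L) (auto simp: derivative_def)

text \<open>The states of the accepting automaton are the derivatives themselves (Brzozowski).\<close>

lemma regular_languageI_derivatives:
  assumes "finite \<Gamma>" "finite Q" "L \<in> Q" "L \<subseteq> lists \<Gamma>"
    and closed: "\<And>K c. K \<in> Q \<Longrightarrow> c \<in> \<Gamma> \<Longrightarrow> derivative c K \<in> Q"
  shows "regular_language \<Gamma> L"
proof -
  \<comment> \<open>Automata have natural numbers as states, so the languages in \<open>Q\<close>
    are coded injectively.\<close>
  obtain e :: "'a list set \<Rightarrow> nat" where e: "inj_on e Q"
    using finite_imp_inj_to_nat_seg[OF \<open>finite Q\<close>] by blast
  define M where "M = \<lparr>states = e ` Q, initial = e L,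
    transitions = {(e K, c, e (derivative c K)) | K c. K \<in> Q \<and> c \<in> \<Gamma>},
    final = e ` {K \<in> Q. [] \<in> K}\<rparr>"
  have "finite_automaton \<Gamma> M"
    using assms by (auto simp: finite_automaton_def M_def)
  moreover have "accepts M w \<longleftrightarrow> w \<in> L" for w
  proof -
    have step: "step_set M {e K} c = (if c \<in> \<Gamma> then {e (derivative c K)} else {})" if "K \<in> Q" for K c
      using that inj_onD[OF e] by (auto simp: step_set_def M_def)
    have empty: "foldl (step_set M) {} w = {}" for w
      by (induction w) (auto simp: step_set_def)
    have "foldl (step_set M) {e K} w =
      (if w \<in> lists \<Gamma> then {e (foldl (\<lambda>L c. derivative c L) K w)} else {})" if "K \<in> Q" for K
      using that by (induction w arbitrary: K) (auto simp: step empty closed)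
    moreover have "foldl (\<lambda>L c. derivative c L) K w \<in> Q" if "K \<in> Q" "w \<in> lists \<Gamma>" for K
      using that by (induction w arbitrary: K) (auto simp: closed)
    ultimately show ?thesis
      using assms inj_on_eq_iff[OF e]
      by (auto simp: accepts_iff M_def foldl_derivative image_iff)
  qed
  ultimately show ?thesis
    unfolding regular_language_def using \<open>finite \<Gamma>\<close> by blast
qed

section \<open>Convolutions of two words\<close>

lemma convolution2_altdef:
  "convolution [x, y] = map (\<lambda>k. [if k < length x then Some (x ! k) else None,
      if k < length y then Some (y ! k) else None]) [0..<max (length x) (length y)]"
  by (simp add: convolution_def)

lemma convolution2_simps [simp]:
  "convolution [[], []] = []"
  "convolution [a # x, b # y] = [Some a, Some b] # convolution [x, y]"
  "convolution [a # x, []] = [Some a, None] # convolution [x, []]"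
  "convolution [[], b # y] = [None, Some b] # convolution [[], y]"
  unfolding convolution2_altdef by (simp_all add: map_upt_Suc del: upt_Suc)

text \<open>Prefixes of equal length need no padding, so the remainders start at the same
  position.\<close>

lemma convolution2_append:
  "length v = length u \<Longrightarrow> convolution [v @ x, u @ y] = convolution [v, u] @ convolution [x, y]"
  by (induction v u rule: list_induct2) auto

text \<open>Regularity of a relation concerns its image under \<open>convolution\<close>;
  injectivity recovers membership in the relation from acceptance.\<close>

lemma convolution2_inject:
  "convolution [x, y] = convolution [x', y'] \<longleftrightarrow> x = x' \<and> y = y'"
proof (induction x y arbitrary: x' y' rule: list_induct2')
  case 1 then show ?case by (cases x'; cases y') auto
next
  case (2 a x)
  have "convolution [x, []] = convolution [z, []] \<longleftrightarrow> x = z" for z :: "'a list"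
  proof (induction x arbitrary: z)
    case Nil show ?case by (cases z) auto
  next
    case (Cons c x) then show ?case by (cases z) auto
  qed
  then show ?case by (cases x'; cases y') auto
next
  case (3 b y)
  have "convolution [[], y] = convolution [[], z] \<longleftrightarrow> y = z" for z :: "'a list"
  proof (induction y arbitrary: z)
    case Nil show ?case by (cases z) auto
  next
    case (Cons c y) then show ?case by (cases z) auto
  qed
  then show ?case by (cases x'; cases y') auto
next
  case (4 a x b y) then show ?case by (cases x'; cases y') auto
qed

lemma convolution2_eq_Cons_iff:
  "convolution [x, y] = c # w \<longleftrightarrow>
    (\<exists>a x' b y'. c = [Some a, Some b] \<and> x = a # x' \<and> y = b # y' \<and> w = convolution [x', y']) \<or>
    (\<exists>a x'. c = [Some a, None] \<and> x = a # x' \<and> y = [] \<and> w = convolution [x', []]) \<or>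
    (\<exists>b y'. c = [None, Some b] \<and> x = [] \<and> y = b # y' \<and> w = convolution [[], y'])"
  by (cases x; cases y) auto

lemma convolution2_in_lists:
  "x \<in> lists \<Sigma> \<Longrightarrow> y \<in> lists \<Sigma> \<Longrightarrow> convolution [x, y] \<in> lists (conv_alphabet \<Sigma> 2)"
  by (fastforce simp: convolution2_altdef conv_alphabet_def in_lists_conv_set less_max_iff_disj)

lemma finite_conv_alphabet: "finite \<Sigma> \<Longrightarrow> finite (conv_alphabet \<Sigma> n)"
  using finite_lists_length_eq[of "insert None (Some ` \<Sigma>)" n]
  by (simp add: conv_alphabet_def conj_commute)

section \<open>Regularity of the lexicographic order\<close>

definition conv_prod :: "'c list set \<Rightarrow> 'c list set \<Rightarrow> 'c option list list set" where
  "conv_prod K L = {convolution [x, y] | x y. x \<in> K \<and> y \<in> L}"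

definition conv_lex :: "'c::linorder list set \<Rightarrow> 'c list set \<Rightarrow> 'c option list list set" where
  "conv_lex K L = {convolution [x, y] | x y. x \<in> K \<and> y \<in> L \<and> lexordp_eq x y}"

text \<open>A padding symbol shows that the word in that component has ended, so the language left
  for it is \<open>{[]}\<close>.\<close>

lemma derivative_conv_prod:
  "derivative c (conv_prod K L) \<in>
    {{}} \<union> {conv_prod (derivative a K) (derivative b L) | a b. c = [Some a, Some b]}
      \<union> {conv_prod (derivative a K) {[]} | a. c = [Some a, None]}
      \<union> {conv_prod {[]} (derivative b L) | b. c = [None, Some b]}"
proof -
  have eq: "derivative c (conv_prod K L) = {w. \<exists>x y. convolution [x, y] = c # w \<and> x \<in> K \<and> y \<in> L}"
    by (auto simp: derivative_def conv_prod_def dest: sym)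
  consider a b where "c = [Some a, Some b]" | a where "c = [Some a, None]"
    | b where "c = [None, Some b]"
    | "\<nexists>a b. c = [Some a, Some b]" "\<nexists>a. c = [Some a, None]" "\<nexists>b. c = [None, Some b]"
    by blast
  then show ?thesis
  proof cases
    case 1
    then have "derivative c (conv_prod K L) = conv_prod (derivative a K) (derivative b L)"
      unfolding eq convolution2_eq_Cons_iff by (auto simp: conv_prod_def derivative_def)
    with 1 show ?thesis by blast
  next
    case 2
    then have "derivative c (conv_prod K L) = (if [] \<in> L then conv_prod (derivative a K) {[]} else {})"
      unfolding eq convolution2_eq_Cons_iff by (auto simp: conv_prod_def derivative_def)
    with 2 show ?thesis by auto
  next
    case 3
    then have "derivative c (conv_prod K L) = (if [] \<in> K then conv_prod {[]} (derivative b L) else {})"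
      unfolding eq convolution2_eq_Cons_iff by (auto simp: conv_prod_def derivative_def)
    with 3 show ?thesis by auto
  next
    case 4
    then have "derivative c (conv_prod K L) = {}"
      unfolding eq convolution2_eq_Cons_iff by auto
    then show ?thesis by blast
  qed
qed

text \<open>Equal letters leave the comparison open. A smaller letter in the first word decides it,
  after which only membership of the two remainders matters, as expressed by
  \<open>conv_prod\<close>. The same holds when the first word ends before the second. All other
  letters refute the comparison.\<close>

lemma derivative_conv_lex:
  fixes K L :: "'c::linorder list set"
  shows "derivative c (conv_lex K L) \<in>
    {{}} \<union> {conv_lex (derivative a K) (derivative b L) | a b. c = [Some a, Some b]}
      \<union> {conv_prod (derivative a K) (derivative b L) | a b. c = [Some a, Some b]}
      \<union> {conv_prod {[]} (derivative b L) | b. c = [None, Some b]}"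
proof -
  have eq: "derivative c (conv_lex K L)
      = {w. \<exists>x y. convolution [x, y] = c # w \<and> x \<in> K \<and> y \<in> L \<and> lexordp_eq x y}"
    by (auto simp: derivative_def conv_lex_def dest: sym)
  consider a b where "c = [Some a, Some b]" "a = b" | a b where "c = [Some a, Some b]" "a < b"
    | b where "c = [None, Some b]"
    | "\<And>a b. c = [Some a, Some b] \<Longrightarrow> b < a" "\<nexists>b. c = [None, Some b]"
    by (metis linorder_less_linear)
  then show ?thesis
  proof cases
    case 1
    then have "derivative c (conv_lex K L) = conv_lex (derivative a K) (derivative b L)"
      unfolding eq convolution2_eq_Cons_iff
      by (auto 0 4 simp: conv_lex_def derivative_def)
    with 1 show ?thesis by blast
  next
    case 2
    then have "derivative c (conv_lex K L) = conv_prod (derivative a K) (derivative b L)"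
      unfolding eq convolution2_eq_Cons_iff
      by (auto 0 4 simp: conv_prod_def derivative_def)
    with 2 show ?thesis by blast
  next
    case 3
    then have "derivative c (conv_lex K L) = (if [] \<in> K then conv_prod {[]} (derivative b L) else {})"
      unfolding eq convolution2_eq_Cons_iff by (auto simp: conv_prod_def derivative_def)
    with 3 show ?thesis by auto
  next
    case 4
    then have "derivative c (conv_lex K L) = {}"
      unfolding eq convolution2_eq_Cons_iff by (auto dest: order_less_not_sym)
    then show ?thesis by blast
  qed
qed

lemma regular_relation_lex:
  fixes L :: "'c::linorder list set"
  assumes "finite \<Sigma>" "finite Q" "L \<in> Q" "L \<subseteq> lists \<Sigma>"
    and closed: "\<And>K c. K \<in> Q \<Longrightarrow> c \<in> \<Sigma> \<Longrightarrow> derivative c K \<in> Q"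
  shows "regular_relation \<Sigma> 2 {[x, y] | x y. x \<in> L \<and> y \<in> L \<and> lexordp_eq x y}"
proof -
  \<comment> \<open>\<open>{[]}\<close> is the language of a word that has ended, and
    \<open>{}\<close> is its derivative; adding both makes the family closed under all cases of the
    two derivative lemmas.\<close>
  define Q' where "Q' = Q \<union> {{}, {[]}}"
  define P where "P = {{}} \<union> (\<lambda>(K, L). conv_prod K L) ` (Q' \<times> Q') \<union> (\<lambda>(K, L). conv_lex K L) ` (Q' \<times> Q')"
  have Q': "derivative c K \<in> Q'" if "K \<in> Q'" "c \<in> \<Sigma>" for K c
    using that closed by (auto simp: Q'_def)
  have nil: "{[]} \<in> Q'" by (simp add: Q'_def)
  have P: "{} \<in> P" "\<And>K L. K \<in> Q' \<Longrightarrow> L \<in> Q' \<Longrightarrow> conv_prod K L \<in> P"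
    "\<And>K L. K \<in> Q' \<Longrightarrow> L \<in> Q' \<Longrightarrow> conv_lex K L \<in> P"
    unfolding P_def by auto
  have "derivative c K \<in> P" if "K \<in> P" "c \<in> conv_alphabet \<Sigma> 2" for K c
  proof -
    have in_\<Sigma>: "a \<in> \<Sigma>" if "Some a \<in> set c" for a
      using that \<open>c \<in> conv_alphabet \<Sigma> 2\<close> by (auto simp: conv_alphabet_def)
    have "derivative c (conv_prod K1 K2) \<in> P" if "K1 \<in> Q'" "K2 \<in> Q'" for K1 K2
      using derivative_conv_prod[of c K1 K2] Q' nil in_\<Sigma> that by (elim UnE CollectE exE conjE singletonE) (simp_all add: P)
    moreover have "derivative c (conv_lex K1 K2) \<in> P" if "K1 \<in> Q'" "K2 \<in> Q'" for K1 K2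
      using derivative_conv_lex[of c K1 K2] Q' nil in_\<Sigma> that by (elim UnE CollectE exE conjE singletonE) (simp_all add: P)
    moreover have "derivative c {} \<in> P" using P(1) by simp
    moreover have "K = {} \<or> (\<exists>K1\<in>Q'. \<exists>K2\<in>Q'. K = conv_prod K1 K2 \<or> K = conv_lex K1 K2)"
      using \<open>K \<in> P\<close> unfolding P_def by (elim UnE imageE) auto
    ultimately show ?thesis by metis
  qed
  moreover have "conv_lex L L \<in> P" using \<open>L \<in> Q\<close> by (auto simp: P_def Q'_def)
  moreover have "finite P" using \<open>finite Q\<close> by (auto simp: P_def Q'_def)
  moreover have "conv_lex L L \<subseteq> lists (conv_alphabet \<Sigma> 2)"
  proof
    fix w assume "w \<in> conv_lex L L"
    then obtain x y where "w = convolution [x, y]" "x \<in> L" "y \<in> L"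
      unfolding conv_lex_def by blast
    then show "w \<in> lists (conv_alphabet \<Sigma> 2)"
      using \<open>L \<subseteq> lists \<Sigma>\<close> convolution2_in_lists[of x \<Sigma> y] by (simp only: subset_iff)
  qed
  ultimately have "regular_language (conv_alphabet \<Sigma> 2) (conv_lex L L)"
    using finite_conv_alphabet[OF \<open>finite \<Sigma>\<close>] by (intro regular_languageI_derivatives[of _ P])
  moreover have "convolution ` {[x, y] | x y. x \<in> L \<and> y \<in> L \<and> lexordp_eq x y} = conv_lex L L"
    by (auto simp: conv_lex_def image_iff)
  ultimately show ?thesis
    using \<open>L \<subseteq> lists \<Sigma>\<close> by (auto simp: regular_relation_def)
qed

section \<open>Multisets as descending words\<close>

abbreviation descending :: "nat list \<Rightarrow> bool" where
  "descending \<equiv> sorted_wrt (\<ge>)"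

text \<open>The first letter of a descending word is the largest element of its multiset. Different
  first letters decide both orders in the same way; equal ones cancel.\<close>

lemma lexordp_eq_iff_mset_le:
  fixes xs ys :: "nat list"
  assumes "descending xs" "descending ys"
  shows "lexordp_eq xs ys \<longleftrightarrow> mset xs \<le> mset ys"
  using assms
proof (induction xs ys rule: list_induct2')
  case (4 x xs y ys)
  have "mset (a # as) < mset (b # bs)" if "a < b" "descending (a # as)" for a b :: nat and as bs
    using that by (intro ex_gt_imp_less_multiset exI[of _ b]) auto
  from this[of x y xs ys] this[of y x ys xs] 4 show ?case
    by (cases x y rule: linorder_cases) (auto simp: not_le)
qed auto

text \<open>After a letter \<open>c\<close>, the rest must be descending with letters at most
  \<open>c\<close>. As long as the word agrees with \<open>m\<close>, the rest must moreover be
  compared with a suffix of \<open>m\<close>. Finitely many bounds and suffixes occur.\<close>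

lemma descending_lex_derivatives:
  fixes m :: "nat list" and n :: nat
  shows "\<exists>Q. finite Q \<and> {w. descending w \<and> (\<forall>x\<in>set w. x < n) \<and> lexordp_eq w m} \<in> Q \<and>
    (\<forall>K\<in>Q. \<forall>c\<in>{..<n}. derivative c K \<in> Q)"
proof -
  define D where "D c = {w. descending w \<and> (\<forall>x\<in>set w. x < c)}" for c
  define Q where "Q = {{}} \<union> D ` {..n}
    \<union> (\<lambda>(c, s). {w \<in> D c. lexordp_eq w s}) ` ({..n} \<times> set (suffixes m))"
  have QI: "{} \<in> Q" "\<And>d. d \<le> n \<Longrightarrow> D d \<in> Q"
    "\<And>d s. d \<le> n \<Longrightarrow> s \<in> set (suffixes m) \<Longrightarrow> {w \<in> D d. lexordp_eq w s} \<in> Q"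
    unfolding Q_def by blast+
  have "derivative c K \<in> Q" if K: "K \<in> Q" and c: "c \<in> {..<n}" for K c
  proof -
    have D: "derivative c (D d) = (if c < d then D (Suc c) else {})" for d
      by (auto simp: D_def derivative_def less_Suc_eq_le intro: le_less_trans)
    have L: "derivative c {w \<in> D d. lexordp_eq w s} \<in> Q" if s: "s \<in> set (suffixes m)" for d s
    proof (cases s)
      case Nil
      then have "derivative c {w \<in> D d. lexordp_eq w s} = {}" by (auto simp: derivative_def)
      then show ?thesis by (simp add: QI)
    next
      case (Cons e t)
      then have t: "t \<in> set (suffixes m)" using s by (auto dest: suffix_ConsD)
      have "derivative c {w \<in> D d. lexordp_eq w s} =
        {w \<in> derivative c (D d). c < e \<or> c = e \<and> lexordp_eq w t}"
        by (auto simp: derivative_def Cons)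
      also have "\<dots> = (if c < d then if c < e then D (Suc c) else if c = e
          then {w \<in> D (Suc c). lexordp_eq w t} else {} else {})"
        by (auto simp: D)
      also have "\<dots> \<in> Q" using c t QI by (simp del: set_suffixes_eq)
      finally show ?thesis .
    qed
    have "derivative c (D d) \<in> Q" for d
      using c QI by (simp add: D)
    moreover have "derivative c {} \<in> Q"
      using QI by simp
    moreover have "K = {} \<or> (\<exists>d. K = D d) \<or> (\<exists>d. \<exists>s\<in>set (suffixes m). K = {w \<in> D d. lexordp_eq w s})"
      using K unfolding Q_def by (elim UnE imageE) auto
    ultimately show ?thesis
      using L by metis
  qed
  moreover have "finite Q" by (simp add: Q_def)
  moreover have "{w \<in> D n. lexordp_eq w m} \<in> Q" by (rule QI(3)) simp_all
  ultimately show ?thesis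
    by (intro exI[of _ Q]) (simp add: D_def)
qed

section \<open>The upper bound\<close>

text \<open>
  The supremum of the ranks of \<open>R\<close> on \<open>X\<close> is less than \<open>\<omega>\<^sup>n\<close>.  Without the common bound \<open>M\<close>, this
  would only say that it is at most \<open>\<omega>\<^sup>n\<close>.
\<close>

definition rank_below :: "nat \<Rightarrow> 'x rel \<Rightarrow> 'x set \<Rightarrow> bool" where
  "rank_below n R X \<longleftrightarrow> (\<exists>g M. M < {#n#} \<and> (\<forall>x\<in>X. g x \<le> M) \<and>
     (\<forall>x\<in>X. \<forall>y\<in>X. (x, y) \<in> R \<longrightarrow> g x < g y))"

section \<open>Closure properties and relation to ranks\<close>

lemma rank_below_mono:
  assumes "rank_below m R X" "m \<le> n"
  shows "rank_below n R X"
proof -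
  obtain g M where "M < {#m#}" "\<forall>x\<in>X. g x \<le> M" "\<forall>x\<in>X. \<forall>y\<in>X. (x, y) \<in> R \<longrightarrow> g x < g y"
    using assms(1) unfolding rank_below_def by blast
  moreover have "{#m#} \<le> {#n#}" using assms(2) by (simp del: mset_le_single_right_iff)
  ultimately show ?thesis
    unfolding rank_below_def by (meson order.strict_trans2)
qed

lemma rank_below_vimage:
  assumes "rank_below n S Y" "h ` X \<subseteq> Y"
    and "\<And>x y. x \<in> X \<Longrightarrow> y \<in> X \<Longrightarrow> (x, y) \<in> R \<Longrightarrow> (h x, h y) \<in> S"
  shows "rank_below n R X"
proof -
  obtain g M where "M < {#n#}" "\<forall>x\<in>Y. g x \<le> M" "\<forall>x\<in>Y. \<forall>y\<in>Y. (x, y) \<in> S \<longrightarrow> g x < g y"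
    using assms(1) unfolding rank_below_def by blast
  then show ?thesis
    unfolding rank_below_def using assms(2,3)
    by (intro exI[of _ "g \<circ> h"] exI[of _ M]) (auto simp: image_subset_iff)
qed

lemma rank_below_subset: "rank_below n R Y \<Longrightarrow> X \<subseteq> Y \<Longrightarrow> rank_below n R X"
  by (rule rank_below_vimage[where h=id]) auto

lemma rank_below_empty: "rank_below n R {}"
  unfolding rank_below_def by (intro exI[of _ "\<lambda>_. {#}"] exI[of _ "{#}"]) auto

lemma rank_below_singleton: "(x, x) \<notin> R \<Longrightarrow> rank_below n R {x}"
  unfolding rank_below_def by (intro exI[of _ "\<lambda>_. {#}"] exI[of _ "{#}"]) auto

text \<open>Each ranking is extended to the whole type so that it never decreases along
  \<open>R\<close> and strictly increases on reaching its own set. In the sum of the two extensions,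
  every step inside the union is strict in one summand and weak in the other. The sum of the bounds
  stays below \<omega>^n, since its elements are still smaller than \<open>n\<close>.\<close>

lemma rank_below_Un:
  assumes "trans R" "0 < n" "rank_below n R X" "rank_below n R Y"
  shows "rank_below n R (X \<union> Y)"
proof -
  have ext: "\<exists>h M. M < {#n#} \<and> (\<forall>x. h x \<le> M) \<and> (\<forall>x y. (x, y) \<in> R \<longrightarrow> h x \<le> h y) \<and>
      (\<forall>x y. (x, y) \<in> R \<longrightarrow> y \<in> Z \<longrightarrow> h x < h y)" if Z: "rank_below n R Z" for Z
  proof -
    obtain g M where M: "M < {#n#}" and g: "\<And>x. x \<in> Z \<Longrightarrow> g x \<le> M"
        "\<And>x y. x \<in> Z \<Longrightarrow> y \<in> Z \<Longrightarrow> (x, y) \<in> R \<Longrightarrow> g x < g y"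
      using Z unfolding rank_below_def by blast
    \<comment> \<open>\<open>h x\<close> is the least strict upper bound of \<open>g\<close> on the
      elements of \<open>Z\<close> at or below \<open>x\<close>. The successor
      \<open>add_mset 0 M\<close> is such a bound, and it stays below \<open>{#n#}\<close> because
      \<open>n\<close> is positive.\<close>
    define h where "h x = (LEAST N. \<forall>z\<in>Z. z = x \<or> (z, x) \<in> R \<longrightarrow> g z < N)" for x
    have *: "\<forall>z\<in>Z. z = x \<or> (z, x) \<in> R \<longrightarrow> g z < add_mset 0 M" for x
      using g(1) le_multiset_right_total order.strict_trans1 by blast
    have h_gt: "g z < h x" if "z \<in> Z" "z = x \<or> (z, x) \<in> R" for z x
      using LeastI[of "\<lambda>N. \<forall>z\<in>Z. z = x \<or> (z, x) \<in> R \<longrightarrow> g z < N", OF *] that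
      unfolding h_def by blast
    have h_le: "h x \<le> N" if "\<And>z. z \<in> Z \<Longrightarrow> z = x \<or> (z, x) \<in> R \<Longrightarrow> g z < N" for x N
      unfolding h_def by (rule Least_le) (use that in blast)
    have "add_mset 0 M < {#n#}" using M \<open>0 < n\<close> by simp
    moreover have "h x \<le> add_mset 0 M" for x
      by (rule h_le) (use * in blast)
    moreover have "h x \<le> h y" if "(x, y) \<in> R" for x y
      by (rule h_le) (use that transD[OF \<open>trans R\<close>] in \<open>blast intro: h_gt\<close>)
    moreover have "h x < h y" if "(x, y) \<in> R" "y \<in> Z" for x y
    proof -
      \<comment> \<open>All elements of \<open>Z\<close> at or below \<open>x\<close> are strictly
        below \<open>y\<close>, so \<open>g y\<close> competes in the minimum defining
        \<open>h x\<close>.\<close>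
      have "h x \<le> g y"
        by (rule h_le) (use that transD[OF \<open>trans R\<close>] in \<open>blast intro: g(2)\<close>)
      also have "g y < h y" by (rule h_gt) (use that in auto)
      finally show ?thesis .
    qed
    ultimately show ?thesis by blast
  qed
  obtain h M where h: "M < {#n#}" "\<And>x. h x \<le> M" "\<And>x y. (x, y) \<in> R \<Longrightarrow> h x \<le> h y"
      "\<And>x y. (x, y) \<in> R \<Longrightarrow> y \<in> X \<Longrightarrow> h x < h y"
    using ext[OF assms(3)] by blast
  obtain k N where k: "N < {#n#}" "\<And>x. k x \<le> N" "\<And>x y. (x, y) \<in> R \<Longrightarrow> k x \<le> k y"
      "\<And>x y. (x, y) \<in> R \<Longrightarrow> y \<in> Y \<Longrightarrow> k x < k y"
    using ext[OF assms(4)] by blast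
  have "M + N < {#n#}" using h(1) k(1) by auto
  moreover have "h x + k x \<le> M + N" for x using h(2) k(2) by (intro add_mono)
  moreover have "h x + k x < h y + k y" if "(x, y) \<in> R" "y \<in> X \<union> Y" for x y
    using that h(3,4)[OF that(1)] k(3,4)[OF that(1)]
    by (auto intro: add_less_le_mono add_le_less_mono)
  ultimately show ?thesis
    unfolding rank_below_def by (intro exI[of _ "\<lambda>x. h x + k x"] exI[of _ "M + N"]) auto
qed

lemma rank_below_UN:
  assumes "trans R" "0 < n" "finite I" "\<And>i. i \<in> I \<Longrightarrow> rank_below n R (X i)"
  shows "rank_below n R (\<Union>i\<in>I. X i)"
  using assms(3,4)
  by (induction I rule: finite_induct) (auto intro!: rank_below_Un assms(1,2) rank_below_empty)

lemma rank_below_finite: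
  assumes "trans R" "irrefl R" "0 < n" "finite X"
  shows "rank_below n R X"
  using rank_below_UN[OF assms(1,3,4), of "\<lambda>x. {x}"] assms(2)
  by (auto simp: rank_below_singleton irrefl_def)

text \<open>By induction along \<open>R\<close>, a ranking dominates the rank. With the common bound
  \<open>M\<close> the rank of \<open>u\<close> is at most \<open>M\<close> plus one, still below
  \<omega>^n.\<close>

lemma ordinal_rank_less_of_rank_below:
  fixes R :: "'a::infinite rel"
  assumes "wf R" "trans R" "0 < n" "rank_below n R {y. (y, u) \<in> R}"
  shows "ordinal_rank R u < mset_ord {#n#}"
proof -
  obtain g M where M: "M < {#n#}" and g: "\<And>x. (x, u) \<in> R \<Longrightarrow> g x \<le> M"
      "\<And>x y. (x, u) \<in> R \<Longrightarrow> (y, u) \<in> R \<Longrightarrow> (x, y) \<in> R \<Longrightarrow> g x < g y"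
    using assms(4) unfolding rank_below_def by blast
  have le: "ordinal_rank R x \<le> mset_ord (g x)" if "(x, u) \<in> R" for x
    using assms(1) that
  proof (induction x rule: wf_induct_rule)
    case (less x)
    have "ordinal_rank R y < mset_ord (g x)" if "(y, x) \<in> R" for y
    proof -
      have yu: "(y, u) \<in> R" using that less.prems transD[OF assms(2)] by blast
      have "ordinal_rank R y \<le> mset_ord (g y)" by (rule less.IH[OF that yu])
      also have "\<dots> < mset_ord (g x)" using g(2)[OF yu less.prems that] by simp
      finally show ?thesis .
    qed
    then show ?case by (simp add: ordinal_rank_le_iff[OF assms(1)])
  qed
  have "ordinal_rank R x < mset_ord (add_mset 0 M)" if "(x, u) \<in> R" for x
  proof -
    have "ordinal_rank R x \<le> mset_ord (g x)" by (rule le[OF that])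
    also have "\<dots> < mset_ord (add_mset 0 M)"
      using g(1)[OF that] le_multiset_right_total[of M 0] by (simp add: order.strict_trans1)
    finally show ?thesis .
  qed
  then have "ordinal_rank R u \<le> mset_ord (add_mset 0 M)"
    by (simp add: ordinal_rank_le_iff[OF assms(1)])
  also have "\<dots> < mset_ord {#n#}" using M assms(3) by simp
  finally show ?thesis .
qed

text \<open>The ranks themselves form a ranking. The hypothesis supplies \<omega>^n as their common
  bound, which is below \<omega>^(n+1); hence the shift to \<open>Suc n\<close>.\<close>

lemma rank_below_of_ordinal_rank:
  fixes R :: "'a::infinite rel"
  assumes "wf R" "\<And>x. x \<in> X \<Longrightarrow> ordinal_rank R x < mset_ord {#n#}"
  shows "rank_below (Suc n) R X"
proof -
  define g where "g x = (SOME N. ordinal_rank R x = mset_ord N)" for x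
  have g: "ordinal_rank R x = mset_ord (g x)" if "x \<in> X" for x
    unfolding g_def by (rule someI_ex) (use assms(2)[OF that] less_mset_ord_iff in blast)
  have "g x \<le> {#n#}" if "x \<in> X" for x
    using assms(2)[OF that] unfolding g[OF that] mset_ord_less_iff by simp
  moreover have "g x < g y" if "x \<in> X" "y \<in> X" "(x, y) \<in> R" for x y
    using ordinal_rank_less[OF assms(1) that(3)] by (simp add: g that)
  ultimately show ?thesis
    unfolding rank_below_def by (intro exI[of _ g] exI[of _ "{#n#}"]) auto
qed

section \<open>Finitely many heights for one automaton\<close>

text \<open>\<open>st v u\<close> is the set of states reachable on the convolution of
  \<open>v\<close> and \<open>u\<close>. For prefixes of equal length, acceptance of an extended
  pair depends on the prefixes through this set alone.\<close>

lemma regular_relation2_states: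
  assumes "regular_relation \<Sigma> 2 R"
  shows "\<exists>(Q :: nat set set) st. finite Q \<and> (\<forall>v u. st v u \<in> Q) \<and>
    (\<forall>v u v' u' x y. length v = length u \<and> length v' = length u' \<and> st v u = st v' u' \<longrightarrow>
      ([v @ x, u @ y] \<in> R \<longleftrightarrow> [v' @ x, u' @ y] \<in> R))"
proof -
  obtain M :: "(nat, _) automaton" where M: "finite_automaton (conv_alphabet \<Sigma> 2) M"
      "convolution ` R = {w. accepts M w}"
    using assms unfolding regular_relation_def regular_language_def by blast
  have R: "[x, y] \<in> R \<longleftrightarrow> accepts M (convolution [x, y])" for x y
  proof
    assume "accepts M (convolution [x, y])"
    then have "convolution [x, y] \<in> convolution ` R" using M(2) by auto
    then obtain ws where ws: "ws \<in> R" "convolution ws = convolution [x, y]" by auto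
    then have "length ws = 2" using assms by (auto simp: regular_relation_def)
    then obtain x' y' where "ws = [x', y']" by (auto simp: length_Suc_conv numeral_2_eq_2)
    then show "[x, y] \<in> R" using ws by (simp add: convolution2_inject)
  qed (use M(2) in auto)
  define st where "st v u = foldl (step_set M) {initial M} (convolution [v, u])" for v u
  show ?thesis
  proof (intro exI conjI allI impI)
    show "finite (Pow (states M))" using M(1) by (simp add: finite_automaton_def)
    show "st v u \<in> Pow (states M)" for v u
      unfolding st_def using M(1) foldl_step_set_subset[OF M(1), of "{initial M}"]
      by (auto simp: finite_automaton_def)
    show "[v @ x, u @ y] \<in> R \<longleftrightarrow> [v' @ x, u' @ y] \<in> R"
      if "length v = length u \<and> length v' = length u' \<and> st v u = st v' u'" for v u v' u' x y
      using that by (simp add: R accepts_iff convolution2_append st_def)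
  qed
qed

lemma automatic_height_less:
  fixes A :: "'a::infinite set"
  assumes po: "partial_order_on A le" and wf: "wf (le - Id)"
    and "automatic (order_struct A le)"
  shows "ordinal_height A (le - Id) < oexp omega omega"
proof (rule ccontr)
  define R where "R = le - Id"
  assume "\<not> ordinal_height A (le - Id) < oexp omega omega"
  then have large: "oexp omega omega \<le> (SUP x\<in>A. ordinal_rank R x)"
    by (simp add: ordinal_height_def R_def)
  have wfR: "wf R" and trR: "trans R" and irR: "irrefl R" and leA: "le \<subseteq> A \<times> A"
    using wf partial_order_onD[OF po] trans_diff_Id by (auto simp: R_def irrefl_def)
  obtain \<Sigma> :: "nat set" and f B S where fin: "finite \<Sigma>" and reg: "regular_relation \<Sigma> 2 S"
    and B: "B \<subseteq> lists \<Sigma>" and f: "bij_betw f A B"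
    and le: "\<And>x y. x \<in> A \<Longrightarrow> y \<in> A \<Longrightarrow> (x, y) \<in> le \<longleftrightarrow> [f x, f y] \<in> S"
    and S: "\<And>x y. [x, y] \<in> S \<Longrightarrow> x \<in> B \<and> y \<in> B"
  proof -
    obtain \<Sigma> :: "nat set" and T where T: "automatic_over \<Sigma> T" "struct_iso (order_struct A le) T"
      using assms(3) unfolding automatic_def by blast
    then obtain f S where f: "bij_betw f A (fst T)" and S: "snd T = [(2, S)]"
      and iso: "\<And>xs. length xs = 2 \<Longrightarrow> set xs \<subseteq> A \<Longrightarrow>
        xs \<in> {[x, y] | x y. (x, y) \<in> le} \<longleftrightarrow> map f xs \<in> S"
      unfolding struct_iso_def order_struct_def by (auto simp: list_all2_Cons1)
    have le: "(x, y) \<in> le \<longleftrightarrow> [f x, f y] \<in> S" if "x \<in> A" "y \<in> A" for x y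
      using iso[of "[x, y]"] that by simp
    have reg: "regular_relation \<Sigma> 2 S" and fin: "finite \<Sigma>"
      and S: "\<And>x y. [x, y] \<in> S \<Longrightarrow> x \<in> fst T \<and> y \<in> fst T"
      using T(1) S by (auto simp: automatic_over_def is_struct_def)
    \<comment> \<open>By reflexivity \<open>b\<close> occurs in the pair \<open>[b, b]\<close> of
      \<open>S\<close>, whose components are words over the alphabet.\<close>
    have "b \<in> lists \<Sigma>" if b: "b \<in> fst T" for b
    proof -
      obtain x where x: "x \<in> A" "b = f x" using f b by (auto simp: bij_betw_def)
      then have "(x, x) \<in> le" using partial_order_onD[OF po] by (auto simp: refl_on_def)
      then have "[b, b] \<in> S" using le x by simp
      then have "set [b, b] \<subseteq> lists \<Sigma>" using reg unfolding regular_relation_def by blast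
      then show ?thesis by simp
    qed
    then show thesis
      using that[OF fin reg _ f le S] by blast
  qed
  obtain Q :: "nat set set" and st where Q: "finite Q" "\<forall>v u. st v u \<in> Q"
    and st': "\<forall>v u v' u' x y. length v = length u \<and> length v' = length u' \<and> st v u = st v' u' \<longrightarrow>
      ([v @ x, u @ y] \<in> S \<longleftrightarrow> [v' @ x, u' @ y] \<in> S)"
    using regular_relation2_states[OF reg] by blast
  have st: "[v @ x, u @ y] \<in> S \<longleftrightarrow> [v' @ x, u' @ y] \<in> S"
    if "length v = length u" "length v' = length u'" "st v u = st v' u'" for v u v' u' x y
    using st' that by blast
  define X where "X v u = {x \<in> A. \<exists>w. w \<noteq> [] \<and> f x = v @ w \<and> [f x, u] \<in> S}" for v u
  \<comment> \<open>The two conditions place the height of \<open>X v u\<close> in the interval from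
    \<omega>^n up to, but excluding, \<omega>^(n+1); so this height determines
    \<open>n\<close>.\<close>
  have "\<exists>v u. length v = length u \<and> \<not> rank_below n R (X v u) \<and> rank_below (Suc n) R (X v u)"
    if "0 < n" for n
  proof -
    have "\<exists>x\<in>A. mset_ord {#n#} \<le> ordinal_rank R x"
    proof (rule ccontr)
      assume "\<not> ?thesis"
      then have "(SUP x\<in>A. ordinal_rank R x) \<le> mset_ord {#n#}"
        by (cases "A = {}") (auto intro!: cSUP_least simp: not_le order_less_imp_le)
      also have "\<dots> < oexp omega omega"
        using less_oexp_omega_omega_iff_mset_ord by blast
      finally show False using large by simp
    qed
    then obtain x where "mset_ord {#n#} \<le> ordinal_rank R x" by blast
    \<comment> \<open>The rank of \<open>u\<close> makes the part below \<open>u\<close> too high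
      for \<open>rank_below n\<close>, while minimality keeps all ranks in it below \<omega>^n and
      so yields \<open>rank_below (Suc n)\<close>.\<close>
    then obtain u where u: "mset_ord {#n#} \<le> ordinal_rank R u"
      and min: "\<And>y. (y, u) \<in> R \<Longrightarrow> ordinal_rank R y < mset_ord {#n#}"
      using wfE_min[OF wfR, of x "{x. mset_ord {#n#} \<le> ordinal_rank R x}"] by (auto simp: not_le)
    have above: "\<not> rank_below n R {y. (y, u) \<in> R}"
      using ordinal_rank_less_of_rank_below[OF wfR trR that] u by (auto simp: not_less[symmetric])
    then have "{y. (y, u) \<in> R} \<noteq> {}"
      using rank_below_empty[of n R] by force
    then have uA: "u \<in> A"
      using leA by (auto simp: R_def)
    have Suc: "rank_below (Suc n) R {y. (y, u) \<in> R}"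
      by (rule rank_below_of_ordinal_rank[OF wfR]) (use min in blast)
    define V where "V = {v. set v \<subseteq> \<Sigma> \<and> length v = length (f u)}"
    define F where "F = {y \<in> A. length (f y) \<le> length (f u)}"
    have "finite V" unfolding V_def by (rule finite_lists_length_eq[OF fin])
    have "f ` F \<subseteq> {v. set v \<subseteq> \<Sigma> \<and> length v \<le> length (f u)}"
      using B bij_betwE[OF f] by (auto simp: F_def)
    then have "finite (f ` F)"
      by (rule finite_subset) (rule finite_lists_length_le[OF fin])
    then have "finite F"
      by (rule finite_imageD) (use f in \<open>auto simp: bij_betw_def F_def inj_on_def\<close>)
    have cover: "{y. (y, u) \<in> R} \<subseteq> F \<union> (\<Union>v\<in>V. X v (f u))"
    proof
      fix y assume "y \<in> {y. (y, u) \<in> R}"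
      then have y: "y \<in> A" "[f y, f u] \<in> S" using le leA uA by (auto simp: R_def)
      show "y \<in> F \<union> (\<Union>v\<in>V. X v (f u))"
      proof (cases "length (f y) \<le> length (f u)")
        case False
        define v where "v = take (length (f u)) (f y)"
        have "f y = v @ drop (length (f u)) (f y)" "drop (length (f u)) (f y) \<noteq> []"
          using False by (auto simp: v_def)
        then have "y \<in> X v (f u)" using y unfolding X_def by blast
        moreover have "f y \<in> lists \<Sigma>" using y B bij_betwE[OF f] by blast
        then have "v \<in> V" using False by (auto simp: V_def v_def dest: in_set_takeD)
        ultimately show ?thesis by blast
      qed (use y in \<open>simp add: F_def\<close>)
    qed
    have "\<exists>v\<in>V. \<not> rank_below n R (X v (f u))"
    proof (rule ccontr)
      assume "\<not> ?thesis"
      then have "rank_below n R (F \<union> (\<Union>v\<in>V. X v (f u)))"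
        using rank_below_finite[OF trR irR that \<open>finite F\<close>]
        by (intro rank_below_Un rank_below_UN trR that \<open>finite V\<close>) auto
      then show False using above cover rank_below_subset by blast
    qed
    then obtain v where v: "v \<in> V" "\<not> rank_below n R (X v (f u))" by blast
    \<comment> \<open>The words of \<open>X v (f u)\<close> are longer than \<open>f u\<close>,
      hence different from it, so the order relation to \<open>u\<close> is strict.\<close>
    have "X v (f u) \<subseteq> {y. (y, u) \<in> R}"
      using v(1) le uA by (auto simp: X_def R_def V_def)
    then have "rank_below (Suc n) R (X v (f u))" by (rule rank_below_subset[OF Suc])
    then show ?thesis using v by (auto simp: V_def)
  qed
  then obtain v u where vu: "\<And>n. 0 < n \<Longrightarrow> length (v n) = length (u n)"
      "\<And>n. 0 < n \<Longrightarrow> \<not> rank_below n R (X (v n) (u n))"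
      "\<And>n. 0 < n \<Longrightarrow> rank_below (Suc n) R (X (v n) (u n))"
    by metis
  \<comment> \<open>Exchanging the prefix \<open>v\<close> for \<open>v'\<close> maps
    \<open>X v u\<close> to \<open>X v' u'\<close>. Agreement of \<open>st\<close> on
    \<open>(v, v)\<close> preserves the order among the words; agreement on \<open>(v, u)\<close>
    preserves being below \<open>u\<close>.\<close>
  have transfer: "rank_below k R (X v u)"
    if "length v = length u" "length v' = length u'" "st v v = st v' v'" "st v u = st v' u'"
      "rank_below k R (X v' u')" for v u v' u' k
  proof -
    define h where "h x = inv_into A f (v' @ drop (length v) (f x))" for x
    have h: "h x \<in> A" "f (h x) = v' @ w" "(w \<noteq> [] \<and> [v @ w, u] \<in> S) \<Longrightarrow> h x \<in> X v' u'"
      if "x \<in> A" "f x = v @ w" for x w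
    proof -
      have "(x, x) \<in> le" using that partial_order_onD[OF po] by (auto simp: refl_on_def)
      then have "[v @ w, v @ w] \<in> S" using le that by auto
      \<comment> \<open>The reflexive pair is used to see that the word with the new prefix belongs
        to the domain.\<close>
      then have "[v' @ w, v' @ w] \<in> S" using st[of v v v' v'] \<open>st v v = st v' v'\<close> by blast
      then have "v' @ w \<in> B" using S by blast
      then show A: "h x \<in> A" "f (h x) = v' @ w"
        using f that by (auto simp: h_def bij_betw_def inv_into_into f_inv_into_f)
      \<comment> \<open>Here \<open>u\<close> is consumed completely, so the remainder of the second
        word is \<open>[]\<close>.\<close>
      show "h x \<in> X v' u'" if "w \<noteq> [] \<and> [v @ w, u] \<in> S"
        using A that st[of v u v' u' w "[]"] \<open>length v = length u\<close> \<open>length v' = length u'\<close> \<open>st v u = st v' u'\<close>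
        by (auto simp: X_def)
    qed
    show ?thesis
    proof (rule rank_below_vimage[OF that(5)])
      show "h ` X v u \<subseteq> X v' u'" using h(3) by (auto simp: X_def)
    next
      fix x y assume "x \<in> X v u" "y \<in> X v u" and xy: "(x, y) \<in> R"
      then obtain w z where x: "x \<in> A" "f x = v @ w" and y: "y \<in> A" "f y = v @ z"
        by (auto simp: X_def)
      have "[v @ w, v @ z] \<in> S" using xy le x y by (auto simp: R_def)
      then have "[v' @ w, v' @ z] \<in> S" using st[of v v v' v'] \<open>st v v = st v' v'\<close> by blast
      then have "(h x, h y) \<in> le" using le h(1,2) x y by metis
      moreover have "h x \<noteq> h y"
        using h(2)[OF x] h(2)[OF y] xy x y f by (auto simp: R_def bij_betw_def inj_on_def)
      ultimately show "(h x, h y) \<in> R" by (simp add: R_def)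
    qed
  qed
  define t where "t n = (st (v n) (v n), st (v n) (u n))" for n
  \<comment> \<open>If the values agreed, the \<open>n\<close>-th set would inherit the bound
    \<omega>^(m+1) \<le> \<omega>^n of the \<open>m\<close>-th one, contradicting its
    choice.\<close>
  have t: "t m \<noteq> t n" if "0 < m" "m < n" for m n
  proof
    assume "t m = t n"
    have "rank_below (Suc m) R (X (v n) (u n))"
    proof (rule transfer[of "v n" "u n" "v m" "u m"])
      show "st (v n) (v n) = st (v m) (v m)" "st (v n) (u n) = st (v m) (u m)"
        using \<open>t m = t n\<close> by (simp_all add: t_def)
    qed (use that in \<open>simp_all add: vu\<close>)
    then have "rank_below n R (X (v n) (u n))"
      by (rule rank_below_mono) (use that in simp)
    then show False using vu that by simp
  qed
  have "inj_on t {0<..}"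
    by (rule linorder_inj_onI) (use t in auto)
  moreover have "t ` {0<..} \<subseteq> Q \<times> Q" using Q(2) by (auto simp: t_def)
  then have "finite (t ` {0<..})" by (rule finite_subset) (simp add: Q(1))
  ultimately have "finite {0::nat<..}" using finite_imageD by blast
  then show False using infinite_Ioi by blast
qed

section \<open>Automatic well-orders\<close>

text \<open>The universe contains \<open>M\<close> itself: the height is the supremum of the ranks
  without adding one, so it is attained at the greatest element \<open>M\<close>.\<close>

lemma mset_ord_height_automatic:
  fixes M :: "nat multiset"
  shows "\<exists>(A :: 'a::infinite set) le. partial_order_on A le \<and> wf (le - Id) \<and>
    automatic (order_struct A le) \<and> ordinal_height A (le - Id) = mset_ord M"
proof -
  define A :: "'a set" where "A = mset_code ` {..M}"
  define le :: "'a rel" where "le = {(mset_code N, mset_code K) | N K. N \<le> K \<and> K \<le> M}"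
  define word where "word N = rev (sorted_list_of_multiset N)" for N :: "nat multiset"
  obtain n where n: "\<And>i. i \<in># M \<Longrightarrow> i < n"
    using finite_nat_set_iff_bounded[of "set_mset M"] by auto
  define L where "L = {w. descending w \<and> (\<forall>x\<in>set w. x < n) \<and> lexordp_eq w (word M)}"
  have word: "descending (word N)" "mset (word N) = N" "set (word N) = set_mset N" for N
    by (simp_all add: word_def sorted_wrt_rev)
  have word_mset: "word (mset w) = w" if "descending w" for w
    using that properties_for_sort[of "rev w" w] by (simp add: word_def sorted_wrt_rev)
  have word_lex: "lexordp_eq (word N) (word K) \<longleftrightarrow> N \<le> K" for N K
    by (simp add: lexordp_eq_iff_mset_le word)
  have L: "L = word ` {..M}"
  proof (intro equalityI subsetI)
    fix w assume "w \<in> L"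
    then show "w \<in> word ` {..M}"
      using word_mset[of w] word_lex[of "mset w" M]
      by (intro image_eqI[of _ _ "mset w"]) (simp_all add: L_def lexordp_eq_iff_mset_le word)
  next
    fix w assume "w \<in> word ` {..M}"
    then obtain N where N: "w = word N" "N \<le> M" by auto
    have "M < {#n#}" using n by simp
    with N(2) have "N < {#n#}" by (rule order.strict_trans1)
    with N show "w \<in> L" by (simp add: L_def word word_lex)
  qed
  have "le - Id \<subseteq> code_less" by (auto simp: le_def)
  then have wf: "wf (le - Id)" by (rule wf_subset[OF wf_code_less])
  have po: "partial_order_on A le"
    unfolding partial_order_on_def preorder_on_def
    by (auto simp: A_def le_def refl_on_def antisym_def intro!: transI)
  \<comment> \<open>The universe is an initial segment of the coded multisets, so cutting off the
    rest changes no rank in it.\<close>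
  have rank: "ordinal_rank (le - Id) x = ordinal_rank code_less x" if "x \<in> A" for x
    by (rule ordinal_rank_cong[OF wf wf_code_less _ _ that])
      (auto simp: A_def le_def code_less_def)
  have "ordinal_height A (le - Id) = (SUP N\<in>{..M}. mset_ord N)"
    unfolding ordinal_height_def mset_ord_def using rank by (auto simp: A_def image_image)
  also have "\<dots> = mset_ord M"
    by (rule cSup_eq_maximum) auto
  finally have height: "ordinal_height A (le - Id) = mset_ord M" .
  define T where "T = (L, [(2 :: nat, {[x, y] | x y. x \<in> L \<and> y \<in> L \<and> lexordp_eq x y})])"
  have sub: "L \<subseteq> lists {..<n}" by (auto simp: L_def)
  obtain Q where Q: "finite Q" "L \<in> Q" "\<And>K c. K \<in> Q \<Longrightarrow> c \<in> {..<n} \<Longrightarrow> derivative c K \<in> Q"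
    using descending_lex_derivatives[of n "word M"] unfolding L_def by blast
  have "automatic_over {..<n} T"
    using regular_languageI_derivatives[OF _ Q(1,2) sub Q(3)]
      regular_relation_lex[OF _ Q(1,2) sub Q(3)]
    by (auto simp: automatic_over_def T_def is_struct_def)
  moreover have "struct_iso (order_struct A le) T"
    unfolding struct_iso_def
  proof (intro exI conjI)
    define f :: "'a \<Rightarrow> nat list" where "f x = word (inv mset_code x)" for x
    have f: "f (mset_code N) = word N" for N
      by (simp add: f_def inv_f_f[OF inj_mset_code])
    have inj: "inj word" by (rule inj_on_inverseI[of _ mset]) (simp add: word)
    then show "bij_betw f (fst (order_struct A le)) (fst T)"
      by (auto simp: bij_betw_def inj_on_def order_struct_def T_def L A_def f image_image dest: injD)
    show "list_all2 (\<lambda>(n, R) (m, Q). n = m \<and>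
         (\<forall>xs. length xs = n \<longrightarrow> set xs \<subseteq> fst (order_struct A le) \<longrightarrow> (xs \<in> R \<longleftrightarrow> map f xs \<in> Q)))
       (snd (order_struct A le)) (snd T)"
      by (auto simp: order_struct_def T_def L A_def le_def f word_lex inj_eq[OF inj] length_Suc_conv numeral_2_eq_2)
  qed
  moreover have "is_struct (order_struct A le)"
    by (auto simp: is_struct_def order_struct_def A_def le_def)
  ultimately have "automatic (order_struct A le)"
    unfolding automatic_def by blast
  then show ?thesis using po wf height by blast
qed

theorem theorem1:
  fixes \<alpha> :: "'a::infinite ordinal"
  shows "(\<exists>(A :: 'a set) le. partial_order_on A le \<and> wf (le - Id) \<and>
            automatic (order_struct A le) \<and> ordinal_height A (le - Id) = \<alpha>)
         \<longleftrightarrow> \<alpha> < oexp omega omega"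
proof
  assume "\<alpha> < oexp omega omega"
  then obtain M where "\<alpha> = mset_ord M"
    unfolding less_oexp_omega_omega_iff_mset_ord by blast
  then show "\<exists>(A :: 'a set) le. partial_order_on A le \<and> wf (le - Id) \<and>
      automatic (order_struct A le) \<and> ordinal_height A (le - Id) = \<alpha>"
    using mset_ord_height_automatic by simp
qed (auto intro: automatic_height_less)

end
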